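(* Let $(Q,\lambda,J)$ be any contact triad with contact distribution $\xi=\ker\lambda$, Reeb vector field $X_\lambda$, projection $\pi:TQ\to\xi$, and contact triad metric $g$. Then there exists a unique affine connection $\nabla$ on $Q$ (with torsion tensor $T$) having the following properties: \begin{enumerate} \item $\nabla$ is a Riemannian connection of the triad metric $g$, i.e. $\nabla g=0$. \item $T(X_\lambda,Y)=0$ for all $Y\in TQ$. \item $\nabla_{X_\lambda}X_\lambda=0$, and $\nabla_Y X_\lambda\in\xi$ for all $Y\in\xi$. \item $\nabla^\pi:=\pi\nabla|_\xi$ defines a Hermitian connection of the vector bundle $\xi\to Q$ with Hermitian structure $(d\lambda,J)$. \item The $\xi$-projection $T^\pi:=\pi T$ of the torsion satisfies $T^\pi(JY,Y)=0$ for all $Y$ tangent to $\xi$. \item $\nabla_{JY}X_\lambda+J\nabla_Y X_\lambda=0$ for all $Y\in\xi$. \end{enumerate}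
   Context: $Q$ is a smooth manifold of dimension $2n+1$ with contact form $\lambda$ (i.e. $\lambda\wedge(d\lambda)^n$ is nowhere zero) and $\xi=\ker\lambda$. The Reeb vector field $X_\lambda$ is the unique vector field with $\lambda(X_\lambda)=1$ and $d\lambda(X_\lambda,\cdot)=0$; then $TQ=\mathbb{R}\{X_\lambda\}\oplus\xi$ and $\pi:TQ\to\xi$ is the corresponding projection. A contact triad $(Q,\lambda,J)$ consists of such data with an endomorphism $J:\xi\to\xi$, $J^2=-\mathrm{id}_\xi$, compatible with $d\lambda$: $d\lambda(JY,JZ)=d\lambda(Y,Z)$ for $Y,Z\in\xi$ and $d\lambda(Y,JY)>0$ for $0\ne Y\in\xi$. $J$ is extended to $TQ$ by $J X_\lambda=0$. The contact triad metric is $g(h,k)=\lambda(h)\lambda(k)+d\lambda(\pi h,J\pi k)$. The convention is $d\lambda(X,Y)=X(\lambda(Y))-Y(\lambda(X))-\lambda([X,Y])$. For a section $Y$ of $\xi$ and any $X\in TQ$, $\nabla^\pi_XY=\pi(\nabla_XY)$; it is a Hermitian connection if $\nabla^\pi_X(JY)=J\nabla^\pi_XY$ and $X(g(Y,Z))=g(\nabla^\pi_XY,Z)+g(Y,\nabla^\pi_XZ)$ for all vector fields $X$ on $Q$ and sections $Y,Z$ of $\xi$. The torsion is $T(X,Y)=\nabla_XY-\nabla_YX-[X,Y]$. The unique connection is called the contact triad connection. *)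

theory Defs
  imports "HOL-Analysis.Analysis" "HOL-Library.Function_Algebras"
begin

section \<open>Smooth manifolds\<close>

text \<open>
  \<open>Ck_on k S f\<close> is meant for open \<open>S\<close>: all directional derivatives of \<open>f\<close> along fixed vectors, up to
  order \<open>k\<close>, exist and are continuous on \<open>S\<close>.
\<close>

primrec Ck_on ::
  "nat \<Rightarrow> 'e::euclidean_space set \<Rightarrow> ('e \<Rightarrow> 'f::real_normed_vector) \<Rightarrow> bool"
where
  "Ck_on 0 S f \<longleftrightarrow> continuous_on S f"
| "Ck_on (Suc k) S f \<longleftrightarrow>
     (\<forall>x\<in>S. f differentiable (at x)) \<and> (\<forall>v. Ck_on k S (\<lambda>x. frechet_derivative f (at x) v))"

definition smooth_on ::
  "'e::euclidean_space set \<Rightarrow> ('e \<Rightarrow> 'f::real_normed_vector) \<Rightarrow> bool" where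
  "smooth_on S f \<longleftrightarrow> (\<forall>k. Ck_on k S f)"

text \<open>
  A chart is a pair of an open set and a coordinate map, of which only the values on that set matter.
  The underlying set of a manifold is the whole type \<open>'a\<close>. The atlas need not be maximal.
\<close>

type_synonym ('a, 'e) chart = "'a set \<times> ('a \<Rightarrow> 'e)"
type_synonym ('a, 'e) atlas = "('a, 'e) chart set"

definition smooth_manifold ::
  "('a::{t2_space,second_countable_topology}, 'e::euclidean_space) atlas \<Rightarrow> bool" where
  "smooth_manifold A \<longleftrightarrow>
     (\<forall>(U, \<phi>)\<in>A. open U \<and> open (\<phi> ` U) \<and> homeomorphism U (\<phi> ` U) \<phi> (inv_into U \<phi>)) \<and>
     (\<Union>(U, \<phi>)\<in>A. U) = UNIV \<and>
     (\<forall>(U, \<phi>)\<in>A. \<forall>(V, \<psi>)\<in>A. smooth_on (\<phi> ` (U \<inter> V)) (\<psi> \<circ> inv_into U \<phi>))"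

definition smooth_functions :: "('a, 'e::euclidean_space) atlas \<Rightarrow> ('a \<Rightarrow> real) set" where
  "smooth_functions A = {f. \<forall>(U, \<phi>)\<in>A. smooth_on (\<phi> ` U) (f \<circ> inv_into U \<phi>)}"


section \<open>Tangent vectors and vector fields\<close>

text \<open>
  Sums, products, differences, \<open>0\<close> and \<open>1\<close> of functions, tangent vectors and vector fields are the
  pointwise ones. A tangent vector at \<open>p\<close> is a derivation at \<open>p\<close> of the algebra of smooth functions;
  it is a total functional, set to \<open>0\<close> on functions that are not smooth so that equality of
  functionals is equality of tangent vectors.
\<close>

type_synonym 'a tvec = "('a \<Rightarrow> real) \<Rightarrow> real"
type_synonym 'a vfield = "'a \<Rightarrow> 'a tvec"

definition tscale :: "real \<Rightarrow> 'a tvec \<Rightarrow> 'a tvec" where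
  "tscale c v = (\<lambda>f. c * v f)"

definition tangent_space :: "('a, 'e::euclidean_space) atlas \<Rightarrow> 'a \<Rightarrow> 'a tvec set" where
  "tangent_space A p = {v.
     (\<forall>f\<in>smooth_functions A. \<forall>g\<in>smooth_functions A. v (f + g) = v f + v g) \<and>
     (\<forall>f\<in>smooth_functions A. \<forall>c. v (\<lambda>q. c * f q) = c * v f) \<and>
     (\<forall>f\<in>smooth_functions A. \<forall>g\<in>smooth_functions A. v (f * g) = f p * v g + g p * v f) \<and>
     (\<forall>f. f \<notin> smooth_functions A \<longrightarrow> v f = 0)}"

definition deriv_along :: "'a vfield \<Rightarrow> ('a \<Rightarrow> real) \<Rightarrow> ('a \<Rightarrow> real)" where
  "deriv_along X f = (\<lambda>p. X p f)"

definition vector_fields :: "('a, 'e::euclidean_space) atlas \<Rightarrow> 'a vfield set" where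
  "vector_fields A = {X. (\<forall>p. X p \<in> tangent_space A p) \<and>
     (\<forall>f\<in>smooth_functions A. deriv_along X f \<in> smooth_functions A)}"

definition fscale :: "('a \<Rightarrow> real) \<Rightarrow> 'a vfield \<Rightarrow> 'a vfield" where
  "fscale f X = (\<lambda>p. tscale (f p) (X p))"

definition lie_bracket :: "'a vfield \<Rightarrow> 'a vfield \<Rightarrow> 'a vfield" where
  "lie_bracket X Y = (\<lambda>p f. X p (deriv_along Y f) - Y p (deriv_along X f))"

text \<open>Pointwise application of a one-form or of a bundle endomorphism to a vector field.\<close>

definition at_points :: "('a \<Rightarrow> 'a tvec \<Rightarrow> 'b) \<Rightarrow> 'a vfield \<Rightarrow> 'a \<Rightarrow> 'b" (infixr "\<cdot>" 90) where
  "T \<cdot> X = (\<lambda>p. T p (X p))"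


section \<open>Differential forms\<close>

text \<open>
  A one-form is given by its values \<open>lam p v\<close> on tangent vectors \<open>v\<close> at \<open>p\<close> (values on other
  functionals are irrelevant). Forms of higher degree are given by their values on vector fields;
  since every tangent vector extends to a vector field, this determines them pointwise.
\<close>

definition one_form ::
  "('a, 'e::euclidean_space) atlas \<Rightarrow> ('a \<Rightarrow> 'a tvec \<Rightarrow> real) \<Rightarrow> bool" where
  "one_form A lam \<longleftrightarrow>
     (\<forall>p. \<forall>v\<in>tangent_space A p. \<forall>w\<in>tangent_space A p. lam p (v + w) = lam p v + lam p w) \<and>
     (\<forall>p. \<forall>v\<in>tangent_space A p. \<forall>c. lam p (tscale c v) = c * lam p v) \<and>
     (\<forall>X\<in>vector_fields A. lam \<cdot> X \<in> smooth_functions A)"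

definition ext_deriv ::
  "('a \<Rightarrow> 'a tvec \<Rightarrow> real) \<Rightarrow> 'a vfield \<Rightarrow> 'a vfield \<Rightarrow> ('a \<Rightarrow> real)" where
  "ext_deriv lam X Y =
     deriv_along X (lam \<cdot> Y) - deriv_along Y (lam \<cdot> X) - lam \<cdot> lie_bracket X Y"

text \<open>A form of degree \<open>k\<close> takes a list of \<open>k\<close> vector fields.\<close>

type_synonym 'a form = "'a vfield list \<Rightarrow> 'a \<Rightarrow> real"

definition wedge :: "nat \<Rightarrow> nat \<Rightarrow> 'a form \<Rightarrow> 'a form \<Rightarrow> 'a form" where
  "wedge k l \<alpha> \<beta> Xs = (\<lambda>p.
     (\<Sum>\<sigma> | \<sigma> permutes {..<k + l}.
        of_int (sign \<sigma>) * \<alpha> (map (\<lambda>i. Xs ! \<sigma> i) [0..<k]) p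
                        * \<beta> (map (\<lambda>i. Xs ! \<sigma> i) [k..<k + l]) p)
     / (fact k * fact l))"

primrec two_form_power :: "'a form \<Rightarrow> nat \<Rightarrow> 'a form" where
  "two_form_power \<omega> 0 = (\<lambda>Xs. 1)"
| "two_form_power \<omega> (Suc m) = wedge 2 (2 * m) \<omega> (two_form_power \<omega> m)"

definition contact_volume :: "nat \<Rightarrow> ('a \<Rightarrow> 'a tvec \<Rightarrow> real) \<Rightarrow> 'a form" where
  "contact_volume n lam =
     wedge 1 (2 * n) (\<lambda>Xs. lam \<cdot> (Xs ! 0))
       (two_form_power (\<lambda>Xs. ext_deriv lam (Xs ! 0) (Xs ! 1)) n)"

definition contact_form ::
  "('a, 'e::euclidean_space) atlas \<Rightarrow> nat \<Rightarrow> ('a \<Rightarrow> 'a tvec \<Rightarrow> real) \<Rightarrow> bool" where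
  "contact_form A n lam \<longleftrightarrow> one_form A lam \<and>
     (\<forall>p. \<exists>Xs. length Xs = 2 * n + 1 \<and> set Xs \<subseteq> vector_fields A \<and> contact_volume n lam Xs p \<noteq> 0)"


section \<open>Contact triads\<close>

definition contact_space ::
  "('a, 'e::euclidean_space) atlas \<Rightarrow> ('a \<Rightarrow> 'a tvec \<Rightarrow> real) \<Rightarrow> 'a \<Rightarrow> 'a tvec set" where
  "contact_space A lam p = {v \<in> tangent_space A p. lam p v = 0}"

definition contact_sections ::
  "('a, 'e::euclidean_space) atlas \<Rightarrow> ('a \<Rightarrow> 'a tvec \<Rightarrow> real) \<Rightarrow> 'a vfield set" where
  "contact_sections A lam = {Y \<in> vector_fields A. \<forall>p. Y p \<in> contact_space A lam p}"

definition reeb ::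
  "('a, 'e::euclidean_space) atlas \<Rightarrow> ('a \<Rightarrow> 'a tvec \<Rightarrow> real) \<Rightarrow> 'a vfield" where
  "reeb A lam = (THE X. X \<in> vector_fields A \<and> lam \<cdot> X = 1 \<and>
     (\<forall>Y\<in>vector_fields A. ext_deriv lam X Y = 0))"

definition xi_proj ::
  "('a, 'e::euclidean_space) atlas \<Rightarrow> ('a \<Rightarrow> 'a tvec \<Rightarrow> real) \<Rightarrow> 'a \<Rightarrow> 'a tvec \<Rightarrow> 'a tvec" where
  "xi_proj A lam p v = v - tscale (lam p v) (reeb A lam p)"

text \<open>
  \<open>J p\<close> is an endomorphism of the contact hyperplane at \<open>p\<close>; its values elsewhere are irrelevant.
  Its extension by zero on the Reeb field is \<open>J_ext\<close>.
\<close>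

definition contact_triad ::
  "('a::{t2_space,second_countable_topology}, 'e::euclidean_space) atlas \<Rightarrow> nat \<Rightarrow>
   ('a \<Rightarrow> 'a tvec \<Rightarrow> real) \<Rightarrow> ('a \<Rightarrow> 'a tvec \<Rightarrow> 'a tvec) \<Rightarrow> bool" where
  "contact_triad A n lam J \<longleftrightarrow>
     smooth_manifold A \<and> DIM('e) = 2 * n + 1 \<and> contact_form A n lam \<and>
     (\<forall>p. \<forall>v\<in>contact_space A lam p.
        J p v \<in> contact_space A lam p \<and> J p (J p v) = - v \<and>
        (\<forall>w\<in>contact_space A lam p. J p (v + w) = J p v + J p w) \<and>
        (\<forall>c. J p (tscale c v) = tscale c (J p v))) \<and>
     (\<forall>Y\<in>contact_sections A lam. J \<cdot> Y \<in> contact_sections A lam) \<and>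
     (\<forall>Y\<in>contact_sections A lam. \<forall>Z\<in>contact_sections A lam.
        ext_deriv lam (J \<cdot> Y) (J \<cdot> Z) = ext_deriv lam Y Z) \<and>
     (\<forall>Y\<in>contact_sections A lam. \<forall>p. Y p \<noteq> 0 \<longrightarrow> ext_deriv lam Y (J \<cdot> Y) p > 0)"

definition J_ext ::
  "('a, 'e::euclidean_space) atlas \<Rightarrow> ('a \<Rightarrow> 'a tvec \<Rightarrow> real) \<Rightarrow>
   ('a \<Rightarrow> 'a tvec \<Rightarrow> 'a tvec) \<Rightarrow> 'a \<Rightarrow> 'a tvec \<Rightarrow> 'a tvec" where
  "J_ext A lam J p v = J p (xi_proj A lam p v)"

definition triad_metric ::
  "('a, 'e::euclidean_space) atlas \<Rightarrow> ('a \<Rightarrow> 'a tvec \<Rightarrow> real) \<Rightarrow>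
   ('a \<Rightarrow> 'a tvec \<Rightarrow> 'a tvec) \<Rightarrow> 'a vfield \<Rightarrow> 'a vfield \<Rightarrow> ('a \<Rightarrow> real)" where
  "triad_metric A lam J h k = (lam \<cdot> h) * (lam \<cdot> k) +
     ext_deriv lam (xi_proj A lam \<cdot> h) (J \<cdot> xi_proj A lam \<cdot> k)"


section \<open>Connections\<close>

text \<open>
  The last conjunct fixes the irrelevant values of \<open>D\<close> on arguments that are not smooth vector
  fields, so that equality of HOL functions is equality of connections. \<open>D X Y\<close> is the covariant
  derivative of \<open>Y\<close> in the direction \<open>X\<close>.
\<close>

type_synonym 'a conn = "'a vfield \<Rightarrow> 'a vfield \<Rightarrow> 'a vfield"

definition affine_connection :: "('a, 'e::euclidean_space) atlas \<Rightarrow> 'a conn \<Rightarrow> bool" where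
  "affine_connection A D \<longleftrightarrow>
     (\<forall>X\<in>vector_fields A. \<forall>Y\<in>vector_fields A.
        D X Y \<in> vector_fields A \<and>
        (\<forall>Z\<in>vector_fields A. D (X + Z) Y = D X Y + D Z Y \<and> D X (Y + Z) = D X Y + D X Z) \<and>
        (\<forall>f\<in>smooth_functions A. D (fscale f X) Y = fscale f (D X Y) \<and>
           D X (fscale f Y) = fscale (deriv_along X f) Y + fscale f (D X Y))) \<and>
     (\<forall>X Y. X \<notin> vector_fields A \<or> Y \<notin> vector_fields A \<longrightarrow> D X Y = 0)"

definition torsion :: "'a conn \<Rightarrow> 'a vfield \<Rightarrow> 'a vfield \<Rightarrow> 'a vfield" where
  "torsion D X Y = D X Y - D Y X - lie_bracket X Y"

definition riemannian_connection ::
  "('a, 'e::euclidean_space) atlas \<Rightarrow> ('a vfield \<Rightarrow> 'a vfield \<Rightarrow> 'a \<Rightarrow> real) \<Rightarrow> 'a conn \<Rightarrow> bool" where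
  "riemannian_connection A g D \<longleftrightarrow>
     (\<forall>X\<in>vector_fields A. \<forall>Y\<in>vector_fields A. \<forall>Z\<in>vector_fields A.
        deriv_along X (g Y Z) = g (D X Y) Z + g Y (D X Z))"

definition pi_connection ::
  "('a, 'e::euclidean_space) atlas \<Rightarrow> ('a \<Rightarrow> 'a tvec \<Rightarrow> real) \<Rightarrow> 'a conn \<Rightarrow> 'a conn" where
  "pi_connection A lam D X Y = xi_proj A lam \<cdot> D X Y"

definition hermitian_connection ::
  "('a, 'e::euclidean_space) atlas \<Rightarrow> ('a \<Rightarrow> 'a tvec \<Rightarrow> real) \<Rightarrow>
   ('a \<Rightarrow> 'a tvec \<Rightarrow> 'a tvec) \<Rightarrow> 'a conn \<Rightarrow> bool" where
  "hermitian_connection A lam J E \<longleftrightarrow>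
     (\<forall>X\<in>vector_fields A. \<forall>Y\<in>contact_sections A lam.
        E X (J \<cdot> Y) = J \<cdot> E X Y \<and>
        (\<forall>Z\<in>contact_sections A lam.
           deriv_along X (triad_metric A lam J Y Z) =
             triad_metric A lam J (E X Y) Z + triad_metric A lam J Y (E X Z)))"

end

theory Submission
  imports Defs
begin

text \<open>
  Write \<open>R\<close> for the Reeb field, \<open>\<omega> = d lam\<close>, and \<open>h Y Z = \<omega> Y (J Z)\<close> for the metric on contact sections. With
  respect to the splitting of the tangent bundle into the Reeb direction and the contact distribution,
  the required properties determine the connection block by block, and the formulas obtained in this
  way define a connection that has the properties.

  \<^item> The vanishing of \<open>T(R, Y)\<close> relates \<open>\<nabla>_R Y\<close> and \<open>\<nabla>_Y R\<close> by the bracket \<open>[R, Y]\<close>. The first operator commutes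
    with \<open>J\<close> and the second anticommutes with it, so they are the corresponding parts of \<open>[R, \<cdot>]\<close>, up to
    sign (\<open>nabla_R\<close>, \<open>nabla_of_R\<close>). That \<open>\<nabla>_R\<close> preserves \<open>h\<close> reflects the invariance of \<open>\<omega>\<close> under the Reeb
    flow (\<open>deriv_R_omega\<close>).
  \<^item> For connections on the contact distribution that commute with \<open>J\<close>, the condition \<open>T(J Y, Y) = 0\<close> modulo \<open>R\<close>
    is equivalent to a formula for \<open>\<nabla>_X Y + J \<nabla>_(J X) Y\<close> in terms of brackets (\<open>dbar\<close>). As for the Chern connection, this together with
    the metric gives a formula for \<open>h (\<nabla>_X Y) Z\<close> (\<open>xi_koszul\<close>), which is linear in \<open>Z\<close> over the smooth
    functions and so defines \<open>\<nabla>_X Y\<close> by the Riesz representation (\<open>CS_Riesz\<close>). No Levi-Civita connection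
    is involved.
  \<^item> The component of \<open>\<nabla>_X Y\<close> along \<open>R\<close> for contact sections is \<open>- g Y (\<nabla>_X R)\<close>, since \<open>g\<close> is parallel.

  All this is linear algebra over the ring of smooth functions, together with the Jacobi identity. What
  the manifold has to provide is that one-forms are represented by vector fields and that the Reeb field
  exists and is smooth. Both are derived from local frames (\<open>local_frame\<close>) by a Gram-Schmidt argument
  (\<open>local_Riesz\<close>). In place of restrictions to open sets there are global identities multiplied by a
  smooth function that does not vanish at the given point; dividing by these functions (\<open>SF_local_division\<close>,
  \<open>VF_glue\<close>) yields global objects, as the local ones are unique. The frames come from coordinates: a
  derivation at a point is determined by its values on coordinate functions, by Hadamard's lemma, and
  smooth bump functions extend local functions to the manifold.
\<close>

section \<open>Functions with continuous iterated directional derivatives\<close>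

lemma Ck_on_cong:
  assumes "open S" "\<And>x. x \<in> S \<Longrightarrow> f x = g x"
  shows "Ck_on k S f \<longleftrightarrow> Ck_on k S g"
  using assms(2)
proof (induction k arbitrary: f g)
  case 0
  then show ?case by (simp cong: continuous_on_cong)
next
  case (Suc k)
  have diff: "f differentiable (at x) \<longleftrightarrow> g differentiable (at x)" if "x \<in> S" for x
    using has_derivative_transform_within_open[OF _ assms(1) that, of f _ _ g]
      has_derivative_transform_within_open[OF _ assms(1) that, of g _ _ f] Suc.prems
    unfolding differentiable_def by fastforce
  have "Ck_on k S (\<lambda>x. frechet_derivative f (at x) v) \<longleftrightarrow>
        Ck_on k S (\<lambda>x. frechet_derivative g (at x) v)"
    if "\<And>x. x \<in> S \<Longrightarrow> f differentiable (at x)" for v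
    by (rule Suc.IH)
      (use frechet_derivative_transform_within_open[OF that assms(1) _ Suc.prems] in auto)
  then show ?case
    using diff by auto
qed

text \<open>
  Calculus rules deliver some derivative \<open>f'\<close>, while \<open>Ck_on\<close> speaks of \<open>frechet_derivative\<close>. The
  inductions for sums, products, inverses, compositions and parameter integrals pass through this rule.
\<close>

lemma Ck_on_SucI:
  assumes "open S" "\<And>x. x \<in> S \<Longrightarrow> (f has_derivative f' x) (at x)"
    and "\<And>v. Ck_on k S (\<lambda>x. f' x v)"
  shows "Ck_on (Suc k) S f"
proof -
  have eq: "f' x = frechet_derivative f (at x)" if "x \<in> S" for x
    using assms(2)[OF that] by (rule frechet_derivative_at)
  have "Ck_on k S (\<lambda>x. frechet_derivative f (at x) v)" for v
    by (subst Ck_on_cong[OF assms(1), where g = "\<lambda>x. f' x v"]) (simp_all add: eq assms(3))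
  then show ?thesis
    using assms(2) by (auto simp: differentiable_def)
qed

lemma Ck_on_Suc_has_derivative:
  assumes "Ck_on (Suc k) S f" "x \<in> S"
  shows "(f has_derivative frechet_derivative f (at x)) (at x)"
  using assms by (simp add: frechet_derivative_works)

lemma Ck_on_continuous: "Ck_on k S f \<Longrightarrow> continuous_on S f"
  by (cases k)
    (auto intro!: continuous_at_imp_continuous_on differentiable_imp_continuous_within)

lemma Ck_on_Suc: "Ck_on (Suc k) S f \<Longrightarrow> Ck_on k S f"
proof (induction k arbitrary: f)
  case 0
  then show ?case using Ck_on_continuous[of "Suc 0" S f] by simp
next
  case (Suc k)
  then have "Ck_on k S (\<lambda>x. frechet_derivative f (at x) v)" for v
    by (simp del: Ck_on.simps add: Ck_on.simps(2)[of "Suc k"])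
  with Suc.prems show ?case by simp
qed

lemma Ck_on_subset: "Ck_on k S f \<Longrightarrow> T \<subseteq> S \<Longrightarrow> Ck_on k T f"
  by (induction k arbitrary: f) (auto intro: continuous_on_subset)

lemma Ck_on_local:
  assumes "\<And>x. x \<in> S \<Longrightarrow> \<exists>T. open T \<and> x \<in> T \<and> Ck_on k T f"
  shows "Ck_on k S f"
  using assms
proof (induction k arbitrary: f)
  case 0
  have "continuous (at x) f" if "x \<in> S" for x
    using 0[OF that] continuous_on_eq_continuous_at by auto
  then show ?case
    by (simp add: continuous_at_imp_continuous_on)
next
  case (Suc k)
  have "Ck_on k S (\<lambda>x. frechet_derivative f (at x) v)" for v
    by (rule Suc.IH) (use Suc.prems in fastforce)
  then show ?case
    using Suc.prems by fastforce
qed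

lemma Ck_on_const: "Ck_on k S (\<lambda>x. c)"
  by (induction k arbitrary: c) auto

lemma Ck_on_add:
  assumes "open S" "Ck_on k S f" "Ck_on k S g"
  shows "Ck_on k S (\<lambda>x. f x + g x)"
  using assms(2,3)
proof (induction k arbitrary: f g)
  case 0
  then show ?case by (simp add: continuous_on_add)
next
  case (Suc k)
  show ?case
    by (rule Ck_on_SucI[OF assms(1)
          has_derivative_add[OF Ck_on_Suc_has_derivative[OF Suc.prems(1)]
                                Ck_on_Suc_has_derivative[OF Suc.prems(2)]]])
      (use Suc in auto)
qed

lemma Ck_on_mult:
  fixes f g :: "'e::euclidean_space \<Rightarrow> real"
  assumes "open S" "Ck_on k S f" "Ck_on k S g"
  shows "Ck_on k S (\<lambda>x. f x * g x)"
  using assms(2,3)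
proof (induction k arbitrary: f g)
  case 0
  then show ?case by (simp add: continuous_on_mult)
next
  case (Suc k)
  have "Ck_on k S f" "Ck_on k S g"
    by (rule Ck_on_Suc[OF Suc.prems(1)], rule Ck_on_Suc[OF Suc.prems(2)])
  then show ?case
    by (intro Ck_on_SucI[OF assms(1)
          has_derivative_mult[OF Ck_on_Suc_has_derivative[OF Suc.prems(1)]
                                 Ck_on_Suc_has_derivative[OF Suc.prems(2)]]]
          Ck_on_add Suc.IH assms(1))
      (use Suc.prems in auto)
qed

lemma Ck_on_sum:
  assumes "open S" "finite I" "\<And>i. i \<in> I \<Longrightarrow> Ck_on k S (f i)"
  shows "Ck_on k S (\<lambda>x. \<Sum>i\<in>I. f i x)"
  using assms(2,3) by (induction I) (auto intro: Ck_on_const Ck_on_add assms(1))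

lemma Ck_on_inverse:
  fixes f :: "'e::euclidean_space \<Rightarrow> real"
  assumes "open S" "Ck_on k S f" "\<And>x. x \<in> S \<Longrightarrow> f x \<noteq> 0"
  shows "Ck_on k S (\<lambda>x. inverse (f x))"
  using assms(2)
proof (induction k)
  case 0
  then show ?case using assms(3) by (simp add: continuous_on_inverse)
next
  case (Suc k)
  have inv: "Ck_on k S (\<lambda>x. inverse (f x))"
    by (rule Suc.IH[OF Ck_on_Suc[OF Suc.prems]])
  have der: "((\<lambda>x. inverse (f x)) has_derivative
      (\<lambda>v. (-1) * (inverse (f x) * frechet_derivative f (at x) v * inverse (f x)))) (at x)"
    if "x \<in> S" for x
    using Deriv.has_derivative_inverse[OF assms(3) Ck_on_Suc_has_derivative[OF Suc.prems], OF that that]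
    by simp
  show ?case
  proof (rule Ck_on_SucI[OF assms(1) der])
    have "Ck_on k S (\<lambda>x. frechet_derivative f (at x) v)" for v
      using Suc.prems by simp
    then show "Ck_on k S
        (\<lambda>x. (-1) * (inverse (f x) * frechet_derivative f (at x) v * inverse (f x)))" for v
      by (intro Ck_on_mult[OF assms(1)] Ck_on_const inv)
  qed
qed

lemma Ck_on_inner_const:
  assumes "open S" "Ck_on k S f"
  shows "Ck_on k S (\<lambda>x. f x \<bullet> b)"
  using assms(2)
proof (induction k arbitrary: f)
  case 0
  then show ?case by (auto intro: continuous_intros)
next
  case (Suc k)
  show ?case
    by (rule Ck_on_SucI[OF assms(1)
          has_derivative_inner_left[OF Ck_on_Suc_has_derivative[OF Suc.prems]]])
      (use Suc in auto)
qed

lemma Ck_on_id: "open S \<Longrightarrow> Ck_on k S (\<lambda>x. x)"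
  by (cases k) (auto intro: Ck_on_const)

text \<open>
  By the chain rule a directional derivative of \<open>f \<circ> g\<close> is the sum over \<open>Basis\<close> of a partial derivative
  of \<open>f\<close>, composed with \<open>g\<close>, times a component of the derivative of \<open>g\<close>. The induction hypothesis,
  applied to the partial derivatives of \<open>f\<close>, and the rules for sums and products conclude.
\<close>

lemma Ck_on_compose:
  fixes g :: "'e::euclidean_space \<Rightarrow> 'd::euclidean_space" and f :: "'d \<Rightarrow> real"
  assumes "open S" "open T" "g ` S \<subseteq> T" "Ck_on k S g" "Ck_on k T f"
  shows "Ck_on k S (\<lambda>x. f (g x))"
  using assms(4,5)
proof (induction k arbitrary: f)
  case 0
  then show ?case using assms(3) by (auto intro: continuous_on_compose2)
next
  case (Suc k)
  let ?f' = "\<lambda>y. frechet_derivative f (at y)" and ?g' = "\<lambda>x. frechet_derivative g (at x)"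
  have der: "((\<lambda>x. f (g x)) has_derivative (\<lambda>v. \<Sum>b\<in>Basis. ?f' (g x) b * (?g' x v \<bullet> b))) (at x)"
    if x: "x \<in> S" for x
  proof -
    have f': "(f has_derivative ?f' (g x)) (at (g x))"
      using Ck_on_Suc_has_derivative[OF Suc.prems(2)] assms(3) x by blast
    have chain: "((\<lambda>x. f (g x)) has_derivative (\<lambda>v. ?f' (g x) (?g' x v))) (at x)"
      using has_derivative_compose[OF Ck_on_Suc_has_derivative[OF Suc.prems(1) x] f'] .
    have "?f' (g x) w = (\<Sum>b\<in>Basis. ?f' (g x) b * (w \<bullet> b))" for w
    proof -
      interpret linear "?f' (g x)"
        using f' has_derivative_linear by blast
      have "?f' (g x) w = ?f' (g x) (\<Sum>b\<in>Basis. (w \<bullet> b) *\<^sub>R b)"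
        by (simp add: euclidean_representation)
      also have "\<dots> = (\<Sum>b\<in>Basis. ?f' (g x) b * (w \<bullet> b))"
        by (simp add: sum scale mult.commute)
      finally show ?thesis .
    qed
    then have "(\<lambda>v. ?f' (g x) (?g' x v)) = (\<lambda>v. \<Sum>b\<in>Basis. ?f' (g x) b * (?g' x v \<bullet> b))"
      by (intro ext)
    with chain show ?thesis by (rule back_subst)
  qed
  have "Ck_on k S g"
    by (rule Ck_on_Suc[OF Suc.prems(1)])
  then show ?case
    by (intro Ck_on_SucI[OF assms(1) der] Ck_on_sum Ck_on_mult Suc.IH Ck_on_inner_const assms(1))
      (use Suc.prems in auto)
qed

lemma smooth_on_compose:
  fixes g :: "'e::euclidean_space \<Rightarrow> 'd::euclidean_space" and f :: "'d \<Rightarrow> real"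
  assumes "open S" "open T" "g ` S \<subseteq> T" "smooth_on S g" "smooth_on T f"
  shows "smooth_on S (\<lambda>x. f (g x))"
  using assms(4,5) by (simp add: smooth_on_def Ck_on_compose[OF assms(1-3)])

lemma smooth_on_cong:
  assumes "open S" "\<And>x. x \<in> S \<Longrightarrow> f x = g x"
  shows "smooth_on S f \<longleftrightarrow> smooth_on S g"
  unfolding smooth_on_def by (simp add: Ck_on_cong[OF assms(1), of f g] assms(2))

lemma smooth_on_const: "smooth_on S (\<lambda>x. c)"
  by (simp add: smooth_on_def Ck_on_const)

lemma smooth_on_add:
  "open S \<Longrightarrow> smooth_on S f \<Longrightarrow> smooth_on S g \<Longrightarrow> smooth_on S (\<lambda>x. f x + g x)"
  by (simp add: smooth_on_def Ck_on_add)

lemma smooth_on_mult: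
  fixes f g :: "'e::euclidean_space \<Rightarrow> real"
  shows "open S \<Longrightarrow> smooth_on S f \<Longrightarrow> smooth_on S g \<Longrightarrow> smooth_on S (\<lambda>x. f x * g x)"
  by (simp add: smooth_on_def Ck_on_mult)

lemma smooth_on_inverse:
  fixes f :: "'e::euclidean_space \<Rightarrow> real"
  shows "open S \<Longrightarrow> smooth_on S f \<Longrightarrow> (\<And>x. x \<in> S \<Longrightarrow> f x \<noteq> 0) \<Longrightarrow>
    smooth_on S (\<lambda>x. inverse (f x))"
  by (simp add: smooth_on_def Ck_on_inverse)

lemma smooth_on_local:
  assumes "\<And>x. x \<in> S \<Longrightarrow> \<exists>T. open T \<and> x \<in> T \<and> smooth_on T f"
  shows "smooth_on S f"
  using assms unfolding smooth_on_def by (meson Ck_on_local)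

lemma smooth_on_subset: "smooth_on S f \<Longrightarrow> T \<subseteq> S \<Longrightarrow> smooth_on T f"
  by (auto simp: smooth_on_def intro: Ck_on_subset)

lemma smooth_on_differentiable: "smooth_on S f \<Longrightarrow> x \<in> S \<Longrightarrow> f differentiable (at x)"
  by (auto simp: smooth_on_def dest: spec[of _ "Suc 0"])

lemma smooth_on_frechet_derivative:
  "smooth_on S f \<Longrightarrow> smooth_on S (\<lambda>x. frechet_derivative f (at x) v)"
  unfolding smooth_on_def by (metis Ck_on.simps(2)[THEN iffD1])

lemma smooth_on_continuous: "smooth_on S f \<Longrightarrow> continuous_on S f"
  unfolding smooth_on_def using Ck_on_continuous by blast

lemma smooth_on_inner_const: "open S \<Longrightarrow> smooth_on S (\<lambda>x. x \<bullet> b)"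
  by (simp add: smooth_on_def Ck_on_inner_const Ck_on_id)

section \<open>A bump function\<close>

text \<open>
  The span of the functions \<open>(1/t) ^ m * exp (-1/t)\<close>, continued by zero to \<open>t \<le> 0\<close>, is closed under
  differentiation. Working with the whole family keeps the proof of smoothness free of polynomials
  in \<open>1/t\<close>.
\<close>

definition flat_exp :: "nat \<Rightarrow> real \<Rightarrow> real" where
  "flat_exp m t = (if t > 0 then (1 / t) ^ m * exp (- (1 / t)) else 0)"

text \<open>
  One term of the exponential series at \<open>1/t\<close> dominates \<open>(1/t) ^ (m + 2)\<close>. A quadratic bound is what is
  needed to see that the derivative at \<open>0\<close> exists and vanishes.
\<close>

lemma flat_exp_bound: "\<bar>flat_exp m t\<bar> \<le> fact (m + 2) * t\<^sup>2"
proof (cases "t > 0")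
  case True
  have "(\<Sum>i\<in>{m + 2}. (1 / t) ^ i /\<^sub>R fact i) \<le> (\<Sum>i. (1 / t) ^ i /\<^sub>R fact i)"
    using True by (intro sum_le_suminf summable_exp_generic) auto
  then have "(1 / t) ^ (m + 2) / fact (m + 2) \<le> exp (1 / t)"
    by (simp only: exp_def sum.insert sum.empty finite.emptyI empty_iff not_False_eq_True
        add_0_right scaleR_conv_of_real divide_inverse of_real_eq_id id_apply mult.commute)
  then have "(1 / t) ^ (m + 2) \<le> fact (m + 2) * exp (1 / t)"
    by (simp only: pos_divide_le_eq fact_gt_zero mult.commute)
  then have "(1 / t) ^ m * (1 / t)\<^sup>2 * exp (- (1 / t)) * t\<^sup>2 \<le>
      (fact (m + 2) * exp (1 / t)) * exp (- (1 / t)) * t\<^sup>2"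
    by (intro mult_right_mono) (simp_all only: power_add exp_ge_zero zero_le_power2)
  moreover have "(1 / t) ^ m * (1 / t)\<^sup>2 * exp (- (1 / t)) * t\<^sup>2 = flat_exp m t"
    using True by (simp add: flat_exp_def field_simps)
  moreover have "(fact (m + 2) * exp (1 / t)) * exp (- (1 / t)) * t\<^sup>2 = fact (m + 2) * t\<^sup>2"
    by (simp add: exp_minus del: fact_Suc)
  moreover have "flat_exp m t \<ge> 0"
    using True by (simp add: flat_exp_def)
  ultimately show ?thesis by linarith
qed (simp add: flat_exp_def)

lemma flat_exp_has_derivative:
  "(flat_exp m has_real_derivative flat_exp (m + 2) t - real m * flat_exp (m + 1) t) (at t)"
proof (cases t "0 :: real" rule: linorder_cases)
  case less
  have "((\<lambda>t. 0) has_real_derivative 0) (at t)" by simp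
  then have "(flat_exp m has_real_derivative 0) (at t)"
    by (rule has_field_derivative_transform_within_open[where S = "{..<0}"]) (use less in \<open>auto simp: flat_exp_def\<close>)
  then show ?thesis using less by (simp add: flat_exp_def)
next
  case equal
  have "((\<lambda>h. flat_exp m h / h) \<longlongrightarrow> 0) (at 0)"
  proof (rule tendsto_0_le[where K = 1])
    show "((\<lambda>h. fact (m + 2) * h) \<longlongrightarrow> (0::real)) (at 0)"
      by (auto intro!: tendsto_eq_intros)
    show "\<forall>\<^sub>F h in at 0. norm (flat_exp m h / h) \<le> norm (fact (m + 2) * h) * 1"
    proof (rule eventually_at_ball[THEN eventually_mono, of 1 0 UNIV])
      fix h :: real
      assume "h \<in> ball 0 1 \<and> h \<in> UNIV"
      show "norm (flat_exp m h / h) \<le> norm (fact (m + 2) * h) * 1"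
        using flat_exp_bound[of m h] 
        by (cases "h = 0") (auto simp: abs_mult divide_simps power2_eq_square mult.assoc)
    qed simp
  qed
  then show ?thesis
    using equal by (simp add: DERIV_def flat_exp_def)
next
  case greater
  have "((\<lambda>t. (1 / t) ^ m * exp (- (1 / t))) has_real_derivative
      flat_exp (m + 2) t - real m * flat_exp (m + 1) t) (at t)"
    using greater
    by (auto intro!: derivative_eq_intros simp: flat_exp_def divide_simps)
       (cases m; simp add: field_simps power2_eq_square)
  then show ?thesis
    by (rule has_field_derivative_transform_within_open[where S = "{0<..}"])
      (use greater in \<open>auto simp: flat_exp_def\<close>)
qed

lemma Ck_on_flat_exp: "Ck_on k UNIV (flat_exp m)"
proof (induction k arbitrary: m)
  case 0
  show ?case
    by (simp add: DERIV_continuous[OF flat_exp_has_derivative] continuous_at_imp_continuous_on)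
next
  case (Suc k)
  have der: "(flat_exp m has_derivative
      (\<lambda>v. (flat_exp (m + 2) t + (- real m) * flat_exp (m + 1) t) * v)) (at t)" for t
    using flat_exp_has_derivative[of m t] by (simp add: has_field_derivative_def)
  show ?case
    by (rule Ck_on_SucI[OF open_UNIV der]) (intro Ck_on_mult Ck_on_add Ck_on_const Suc.IH open_UNIV)
qed

lemma exists_smooth_bump:
  fixes c :: "'e::euclidean_space"
  assumes "r > 0"
  obtains b :: "'e \<Rightarrow> real"
  where "smooth_on UNIV b" "b c \<noteq> 0" "\<And>x. x \<notin> ball c r \<Longrightarrow> b x = 0"
proof
  \<comment> \<open>The argument is \<open>r\<^sup>2 - (dist c x)\<^sup>2\<close>, written out as a polynomial in the coordinates.\<close>
  let ?b = "\<lambda>x. flat_exp 0 (r\<^sup>2 + (-1) * (\<Sum>i\<in>Basis. (x \<bullet> i + - (c \<bullet> i)) * (x \<bullet> i + - (c \<bullet> i))))"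
  show "smooth_on UNIV ?b"
    unfolding smooth_on_def
    by (rule allI, rule Ck_on_compose[OF open_UNIV open_UNIV subset_UNIV _ Ck_on_flat_exp])
      (intro Ck_on_add Ck_on_const Ck_on_mult Ck_on_sum Ck_on_inner_const Ck_on_id open_UNIV finite_Basis)
  show "?b c \<noteq> 0"
    using assms by (simp add: flat_exp_def)
  show "?b x = 0" if "x \<notin> ball c r" for x
  proof -
    have "(\<Sum>i\<in>Basis. (x \<bullet> i + - (c \<bullet> i)) * (x \<bullet> i + - (c \<bullet> i))) = (x - c) \<bullet> (x - c)"
      by (subst euclidean_inner) (simp add: inner_diff_left)
    also have "\<dots> = (dist c x)\<^sup>2"
      by (simp add: dist_norm norm_minus_commute[of c] power2_norm_eq_inner)
    also have "\<dots> \<ge> r\<^sup>2"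
      using that assms by (intro power_mono) auto
    finally show ?thesis by (simp add: flat_exp_def)
  qed
qed

section \<open>Hadamard's lemma\<close>

text \<open>
  Differentiating under the integral sign in direction \<open>v\<close> replaces \<open>g\<close> by its derivative along \<open>v\<close> and
  produces one more factor \<open>t\<close>. The weight \<open>t ^ j\<close> makes the statement stable under this step.
\<close>

lemma Ck_on_radial_integral:
  fixes g :: "'e::euclidean_space \<Rightarrow> real"
  assumes "open S" "convex S" "a \<in> S" "Ck_on k S g"
  shows "Ck_on k S (\<lambda>x. integral (cbox 0 1) (\<lambda>t. t ^ j * g (a + t *\<^sub>R (x - a))))"
proof -
  have inS: "a + t *\<^sub>R (x - a) \<in> S" if "x \<in> S" "t \<in> cbox 0 1" for x t
  proof -
    have "(1 - t) *\<^sub>R a + t *\<^sub>R x \<in> S"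
      using assms(2,3) that by (auto simp: convex_alt)
    then show ?thesis by (simp add: algebra_simps)
  qed
  show ?thesis
    using assms(4)
  proof (induction k arbitrary: g j)
    case 0
    have "continuous_on (S \<times> cbox 0 1) (\<lambda>(x, t). t ^ j * g (a + t *\<^sub>R (x - a)))"
      unfolding case_prod_beta
      by (rule continuous_on_mult, (intro continuous_intros)[1],
          rule continuous_on_compose2[of S g]) (use 0 inS in \<open>auto intro!: continuous_intros\<close>)
    then show ?case
      by (simp only: Ck_on.simps) (rule integral_continuous_on_param)
  next
    case (Suc k)
    let ?g' = "\<lambda>y. frechet_derivative g (at y)"
    define F where "F x t = Blinfun (\<lambda>v. t ^ Suc j * ?g' (a + t *\<^sub>R (x - a)) v)" for x t
    have bl: "bounded_linear (?g' y)" if "y \<in> S" for y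
      using Ck_on_Suc_has_derivative[OF Suc.prems that] has_derivative_bounded_linear by blast
    have F: "blinfun_apply (F x t) v = t ^ Suc j * ?g' (a + t *\<^sub>R (x - a)) v"
      if "x \<in> S" "t \<in> cbox 0 1" for x t v
      unfolding F_def
      by (subst bounded_linear_Blinfun_apply)
        (auto intro!: bounded_linear_const_mult bl inS that)
    have cont: "continuous_on S (\<lambda>y. ?g' y v)" for v
      using Suc.prems by (auto intro: Ck_on_continuous)
    have contg: "continuous_on S g"
      using Suc.prems by (rule Ck_on_continuous)
    have contF: "continuous_on (S \<times> cbox 0 1) (\<lambda>(x, t). F x t)"
    proof (rule continuous_on_blinfun_componentwise)
      fix i :: 'e
      have "continuous_on (S \<times> cbox 0 1) (\<lambda>z. snd z ^ Suc j * ?g' (a + snd z *\<^sub>R (fst z - a)) i)"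
        by (rule continuous_on_mult, (intro continuous_intros)[1],
            rule continuous_on_compose2[OF cont[of i]])
          (use inS in \<open>auto intro!: continuous_intros\<close>)
      then show "continuous_on (S \<times> cbox 0 1) (\<lambda>z. blinfun_apply (case z of (x, t) \<Rightarrow> F x t) i)"
        by (rule continuous_on_eq) (auto simp: F)
    qed
    have der: "((\<lambda>x. integral (cbox 0 1) (\<lambda>t. t ^ j * g (a + t *\<^sub>R (x - a)))) has_derivative
        (\<lambda>v. integral (cbox 0 1) (\<lambda>t. t ^ Suc j * ?g' (a + t *\<^sub>R (x - a)) v))) (at x)"
      if x: "x \<in> S" for x
    proof -
      have "((\<lambda>x. integral (cbox 0 1) (\<lambda>t. t ^ j * g (a + t *\<^sub>R (x - a)))) has_derivative
          blinfun_apply (integral (cbox 0 1) (F x))) (at x within S)"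
      proof (rule leibniz_rule[where fx = F, OF _ _ contF x assms(2)])
        fix y t
        assume yt: "y \<in> S" "t \<in> cbox (0::real) 1"
        have "((\<lambda>y. t ^ j * g (a + t *\<^sub>R (y - a))) has_derivative
            (\<lambda>v. t ^ j * ?g' (a + t *\<^sub>R (y - a)) (t *\<^sub>R v))) (at y within S)"
          by (rule has_derivative_mult_right, rule has_derivative_compose[where g = g and
                f = "\<lambda>y. a + t *\<^sub>R (y - a)", OF _
                Ck_on_Suc_has_derivative[OF Suc.prems inS[OF yt]]])
            (auto intro!: derivative_eq_intros)
        moreover have "(\<lambda>v. t ^ j * ?g' (a + t *\<^sub>R (y - a)) (t *\<^sub>R v)) = blinfun_apply (F y t)"
          using F[OF yt] linear_cmul[OF bounded_linear.linear[OF bl[OF inS[OF yt]]]] by (auto simp: mult_ac)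
        ultimately show "((\<lambda>y. t ^ j * g (a + t *\<^sub>R (y - a))) has_derivative
            blinfun_apply (F y t)) (at y within S)" by simp
      next
        fix y assume y: "y \<in> S"
        show "(\<lambda>t. t ^ j * g (a + t *\<^sub>R (y - a))) integrable_on cbox 0 1"
          by (rule integrable_continuous, rule continuous_on_mult, (intro continuous_intros)[1],
              rule continuous_on_compose2[OF contg])
            (use inS y in \<open>auto intro!: continuous_intros\<close>)
      qed
      moreover have "blinfun_apply (integral (cbox 0 1) (F x)) =
          (\<lambda>v. integral (cbox 0 1) (\<lambda>t. t ^ Suc j * ?g' (a + t *\<^sub>R (x - a)) v))"
      proof
        fix v
        have "continuous_on (cbox 0 1) (\<lambda>t. (\<lambda>(x, t). F x t) (x, t))"
          by (rule continuous_on_compose2[OF contF])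
            (use x in \<open>auto intro!: continuous_on_Pair continuous_on_const continuous_on_id\<close>)
        then have "F x integrable_on cbox 0 1"
          by (simp add: integrable_continuous_interval)
        then have "blinfun_apply (integral (cbox 0 1) (F x)) v =
            integral (cbox 0 1) (\<lambda>t. blinfun_apply (F x t) v)"
          by (simp add: blinfun_apply_integral)
        also have "\<dots> = integral (cbox 0 1) (\<lambda>t. t ^ Suc j * ?g' (a + t *\<^sub>R (x - a)) v)"
          using F[OF x] by (intro integral_cong)
        finally show "blinfun_apply (integral (cbox 0 1) (F x)) v =
            integral (cbox 0 1) (\<lambda>t. t ^ Suc j * ?g' (a + t *\<^sub>R (x - a)) v)" .
      qed
      ultimately show ?thesis
        using at_within_open[OF x assms(1)] by simp
    qed
    show ?case
      by (rule Ck_on_SucI[OF assms(1) der], assumption, rule Suc.IH) (use Suc.prems in simp)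
  qed
qed

text \<open>
  The fundamental theorem of calculus along the segment from \<open>a\<close> to \<open>x\<close>. Smoothness of the coefficients
  \<open>h i\<close> is essential for the use made of the lemma: a derivation at \<open>a\<close> annihilates a product of two
  functions that vanish at \<open>a\<close>, so it sees \<open>g\<close> only through the values \<open>h i a\<close>.
\<close>

lemma Hadamard:
  fixes g :: "'e::euclidean_space \<Rightarrow> real"
  assumes S: "open S" "convex S" "a \<in> S" and g: "smooth_on S g"
  obtains h where "\<And>i. smooth_on S (h i)"
    and "\<And>i. h i a = frechet_derivative g (at a) i"
    and "\<And>x. x \<in> S \<Longrightarrow> g x = g a + (\<Sum>i\<in>Basis. ((x - a) \<bullet> i) * h i x)"
proof
  define h where "h i x = integral (cbox 0 1)
    (\<lambda>t::real. t ^ 0 * frechet_derivative g (at (a + t *\<^sub>R (x - a))) i)" for i x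
  have g': "smooth_on S (\<lambda>x. frechet_derivative g (at x) i)" for i
    by (rule smooth_on_frechet_derivative[OF g])
  show "smooth_on S (h i)" for i
    using g' Ck_on_radial_integral[OF S] unfolding smooth_on_def h_def by blast
  show "h i a = frechet_derivative g (at a) i" for i
    by (simp add: h_def)
  show "g x = g a + (\<Sum>i\<in>Basis. ((x - a) \<bullet> i) * h i x)" if x: "x \<in> S" for x
  proof -
    let ?l = "\<lambda>t. a + t *\<^sub>R (x - a)"
    have inS: "?l t \<in> S" if "t \<in> {0..1}" for t
    proof -
      have "(1 - t) *\<^sub>R a + t *\<^sub>R x \<in> S"
        using S that x by (auto simp: convex_alt)
      then show ?thesis by (simp add: algebra_simps)
    qed
    have dg: "(g has_derivative frechet_derivative g (at (?l t))) (at (?l t))" if "t \<in> {0..1}" for t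
      using smooth_on_differentiable[OF g inS[OF that]] by (simp add: frechet_derivative_works)
    have "((\<lambda>t. frechet_derivative g (at (?l t)) (x - a)) has_integral (g (?l 1) - g (?l 0))) {0..1}"
    proof (rule fundamental_theorem_of_calculus)
      fix t :: real assume t: "t \<in> {0..1}"
      have "((\<lambda>t. g (?l t)) has_derivative
          (\<lambda>s. frechet_derivative g (at (?l t)) (s *\<^sub>R (x - a)))) (at t within {0..1})"
        by (rule has_derivative_compose[where g = g and f = ?l, OF _ dg[OF t]]) (auto intro!: derivative_eq_intros)
      moreover have "frechet_derivative g (at (?l t)) (s *\<^sub>R (x - a)) =
          s *\<^sub>R frechet_derivative g (at (?l t)) (x - a)" for s
        using linear_cmul has_derivative_linear[OF dg[OF t]] by blast
      ultimately show "((\<lambda>t. g (?l t)) has_vector_derivative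
          frechet_derivative g (at (?l t)) (x - a)) (at t within {0..1})"
        by (simp add: has_vector_derivative_def)
    qed simp
    then have "g x - g a = integral {0..1} (\<lambda>t. frechet_derivative g (at (?l t)) (x - a))"
      by (simp add: integral_unique)
    also have "\<dots> = integral {0..1}
        (\<lambda>t. \<Sum>i\<in>Basis. ((x - a) \<bullet> i) * frechet_derivative g (at (?l t)) i)"
    proof (rule integral_cong)
      fix t :: real assume t: "t \<in> {0..1}"
      interpret linear "frechet_derivative g (at (?l t))"
        by (rule has_derivative_linear[OF dg[OF t]])
      have "frechet_derivative g (at (?l t)) (\<Sum>i\<in>Basis. ((x - a) \<bullet> i) *\<^sub>R i) =
          (\<Sum>i\<in>Basis. ((x - a) \<bullet> i) * frechet_derivative g (at (?l t)) i)"
        by (simp only: sum scale real_scaleR_def)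
      then show "frechet_derivative g (at (?l t)) (x - a) =
          (\<Sum>i\<in>Basis. ((x - a) \<bullet> i) * frechet_derivative g (at (?l t)) i)"
        by (simp only: euclidean_representation)
    qed
    also have "\<dots> = (\<Sum>i\<in>Basis. ((x - a) \<bullet> i) * h i x)"
    proof (subst integral_sum)
      have "continuous_on S (\<lambda>y. frechet_derivative g (at y) i)" for i
        by (rule smooth_on_continuous[OF g'])
      then have "continuous_on {0..1} (\<lambda>t. frechet_derivative g (at (?l t)) i)" for i
        by (rule continuous_on_compose2) (use inS in \<open>auto intro!: continuous_intros\<close>)
      then show "(\<lambda>t. ((x - a) \<bullet> i) * frechet_derivative g (at (?l t)) i) integrable_on {0..1}" for i
        by (intro integrable_on_mult_right integrable_continuous_interval)
    qed (simp_all add: h_def)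
    finally show ?thesis by simp
  qed
qed

section \<open>Smooth functions and tangent vectors on a manifold\<close>

lemma smooth_on_eqI:
  "smooth_on S f \<Longrightarrow> open S \<Longrightarrow> (\<And>x. x \<in> S \<Longrightarrow> f x = g x) \<Longrightarrow> smooth_on S g"
  using smooth_on_cong[of S f g] by simp

locale manifold =
  fixes A :: "('a::{t2_space,second_countable_topology}, 'e::euclidean_space) atlas"
  assumes manifold: "smooth_manifold A"
begin

abbreviation "SF \<equiv> smooth_functions A"
abbreviation "VF \<equiv> vector_fields A"
abbreviation "TS \<equiv> tangent_space A"

lemma chart_open: "(U, \<phi>) \<in> A \<Longrightarrow> open U \<and> open (\<phi> ` U)"
  using manifold unfolding smooth_manifold_def by blast

lemma chart_homeomorphism: "(U, \<phi>) \<in> A \<Longrightarrow> homeomorphism U (\<phi> ` U) \<phi> (inv_into U \<phi>)"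
  using manifold unfolding smooth_manifold_def by blast

lemma chart_inv [simp]: "(U, \<phi>) \<in> A \<Longrightarrow> q \<in> U \<Longrightarrow> inv_into U \<phi> (\<phi> q) = q"
  using chart_homeomorphism unfolding homeomorphism_def by blast

lemma chart_image_open:
  assumes "(U, \<phi>) \<in> A" "open W" "W \<subseteq> U"
  shows "open (\<phi> ` W)"
proof -
  have "openin (top_of_set U) W"
    using assms(2,3) by (simp add: openin_open_eq chart_open[OF assms(1)])
  then have "openin (top_of_set (\<phi> ` U)) (\<phi> ` W)"
    by (rule homeomorphism_imp_open_map[OF chart_homeomorphism[OF assms(1)]])
  then show ?thesis
    by (rule openin_open_trans) (simp add: chart_open[OF assms(1)])
qed

lemma chart_preimage_open:
  assumes "(U, \<phi>) \<in> A" "open W" "W \<subseteq> \<phi> ` U"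
  shows "open (inv_into U \<phi> ` W)"
proof -
  have "openin (top_of_set (\<phi> ` U)) W"
    using assms(2,3) by (simp add: openin_open_eq chart_open[OF assms(1)])
  then have "openin (top_of_set U) (inv_into U \<phi> ` W)"
    by (rule homeomorphism_imp_open_map[OF homeomorphism_symD[OF chart_homeomorphism[OF assms(1)]]])
  then show ?thesis
    by (rule openin_open_trans) (simp add: chart_open[OF assms(1)])
qed

lemma chart_cover: "\<exists>U \<phi>. (U, \<phi>) \<in> A \<and> p \<in> U"
proof -
  have "p \<in> (\<Union>(U, \<phi>)\<in>A. U)"
    using manifold unfolding smooth_manifold_def by simp
  then show ?thesis by auto
qed

lemma chart_transition:
  "(U, \<phi>) \<in> A \<Longrightarrow> (V, \<psi>) \<in> A \<Longrightarrow> smooth_on (\<phi> ` (U \<inter> V)) (\<psi> \<circ> inv_into U \<phi>)"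
  using manifold unfolding smooth_manifold_def by blast

lemma smooth_functions_chart:
  "f \<in> SF \<Longrightarrow> (U, \<phi>) \<in> A \<Longrightarrow> smooth_on (\<phi> ` U) (f \<circ> inv_into U \<phi>)"
  unfolding smooth_functions_def by blast

lemma smooth_functionsI:
  "(\<And>U \<phi>. (U, \<phi>) \<in> A \<Longrightarrow> smooth_on (\<phi> ` U) (f \<circ> inv_into U \<phi>)) \<Longrightarrow> f \<in> SF"
  unfolding smooth_functions_def by blast

lemma SF_const [simp]: "(\<lambda>q. c) \<in> SF"
  by (rule smooth_functionsI) (simp add: o_def smooth_on_const)

lemma SF_0 [simp]: "0 \<in> SF" and SF_1 [simp]: "1 \<in> SF"
  using SF_const[of 0] SF_const[of 1] by (simp_all add: zero_fun_def one_fun_def)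

lemma SF_add [simp]: "f \<in> SF \<Longrightarrow> g \<in> SF \<Longrightarrow> f + g \<in> SF"
  using smooth_on_add[OF _ smooth_functions_chart smooth_functions_chart] chart_open
  by (intro smooth_functionsI) (force simp: o_def plus_fun_def)

lemma SF_mult [simp]: "f \<in> SF \<Longrightarrow> g \<in> SF \<Longrightarrow> f * g \<in> SF"
  using smooth_on_mult[OF _ smooth_functions_chart smooth_functions_chart] chart_open
  by (intro smooth_functionsI) (force simp: o_def times_fun_def)

lemma SF_cmult [simp]: "f \<in> SF \<Longrightarrow> (\<lambda>q. c * f q) \<in> SF"
  using SF_mult[OF SF_const, of f c] by (simp add: times_fun_def)

lemma SF_uminus [simp]: "f \<in> SF \<Longrightarrow> - f \<in> SF"
  using SF_cmult[of f "-1"] by (simp add: fun_Compl_def)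

lemma SF_diff [simp]: "f \<in> SF \<Longrightarrow> g \<in> SF \<Longrightarrow> f - g \<in> SF"
  using SF_add[of f "- g"] by simp

lemma SF_sum [simp]: "(\<And>i. i \<in> I \<Longrightarrow> f i \<in> SF) \<Longrightarrow> sum f I \<in> SF"
  by (induction I rule: infinite_finite_induct) auto

text \<open>
  Smoothness is local, and a smooth function may be divided by another where the latter does not
  vanish. All gluing below is done in this form: a local statement about \<open>f\<close> near \<open>p\<close> is phrased as a
  global statement about \<open>u * f\<close> with \<open>u p \<noteq> 0\<close>, so that objects need not be restricted to open subsets.
\<close>

lemma SF_local_division:
  assumes "\<And>p. \<exists>u\<in>SF. u p \<noteq> 0 \<and> u * f \<in> SF"
  shows "f \<in> SF"
proof (rule smooth_functionsI, rule smooth_on_local)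
  fix U \<phi> x
  assume c: "(U, \<phi>) \<in> A" and "x \<in> \<phi> ` U"
  then obtain p where p: "p \<in> U" "x = \<phi> p" by blast
  obtain u where u: "u \<in> SF" "u p \<noteq> 0" "u * f \<in> SF" using assms by blast
  let ?i = "inv_into U \<phi>"
  define T where "T = \<phi> ` U \<inter> (u \<circ> ?i) -` (- {0})"
  have "open T"
    unfolding T_def
    by (rule continuous_open_preimage)
      (use smooth_on_continuous[OF smooth_functions_chart[OF u(1) c]] chart_open[OF c] in auto)
  have "smooth_on T (\<lambda>x. ((u * f) \<circ> ?i) x * inverse ((u \<circ> ?i) x))"
    by (intro smooth_on_mult smooth_on_inverse \<open>open T\<close>
        smooth_on_subset[OF smooth_functions_chart[OF u(1) c]]
        smooth_on_subset[OF smooth_functions_chart[OF u(3) c]]) (auto simp: T_def)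
  then have "smooth_on T (f \<circ> ?i)"
    by (rule smooth_on_eqI[OF _ \<open>open T\<close>]) (simp add: T_def)
  moreover have "x \<in> T"
    using p u c by (simp add: T_def)
  ultimately show "\<exists>T. open T \<and> x \<in> T \<and> smooth_on T (f \<circ> ?i)"
    using \<open>open T\<close> by blast
qed

text \<open>
  The product with a bump function supported in a smaller closed coordinate ball is smooth in the
  chart, hence near every point of the larger ball by smoothness of the transition maps. The preimage
  of the closed ball is compact, hence closed in the Hausdorff space, and the product vanishes on its
  open complement.
\<close>

lemma SF_extend_by_zero:
  fixes k :: "'e \<Rightarrow> real"
  assumes c: "(U, \<phi>) \<in> A" and r: "r < R" "ball c R \<subseteq> \<phi> ` U"
    and b: "smooth_on UNIV b" "\<And>x. x \<notin> ball c r \<Longrightarrow> b x = 0"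
    and k: "smooth_on (ball c R) k"
  shows "(\<lambda>q. if q \<in> U then b (\<phi> q) * k (\<phi> q) else 0) \<in> SF" (is "?F \<in> SF")
proof (rule smooth_functionsI, rule smooth_on_local)
  fix V \<psi> y
  assume d: "(V, \<psi>) \<in> A" and "y \<in> \<psi> ` V"
  then obtain q where q: "q \<in> V" "y = \<psi> q" by blast
  define W where "W = inv_into U \<phi> ` ball c R"
  have hom: "homeomorphism U (\<phi> ` U) \<phi> (inv_into U \<phi>)"
    by (rule chart_homeomorphism[OF c])
  have W: "open W" "W \<subseteq> U" "\<phi> ` W \<subseteq> ball c R"
    using chart_preimage_open[OF c _ r(2)] r(2) hom unfolding W_def homeomorphism_def by auto
  show "\<exists>T. open T \<and> y \<in> T \<and> smooth_on T (?F \<circ> inv_into V \<psi>)"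
  proof (cases "q \<in> W")
    case True
    let ?T = "\<psi> ` (V \<inter> W)"
    have T: "open ?T"
      using W(1) chart_open[OF d] by (intro chart_image_open[OF d]) auto
    have "smooth_on ?T (\<phi> \<circ> inv_into V \<psi>)"
      by (rule smooth_on_subset[OF chart_transition[OF d c]]) (use W in blast)
    moreover have "smooth_on (ball c R) (\<lambda>x. b x * k x)"
      by (intro smooth_on_mult k smooth_on_subset[OF b(1)]) auto
    moreover have "(\<phi> \<circ> inv_into V \<psi>) ` ?T \<subseteq> ball c R"
      using W(3) chart_inv[OF d] by auto
    ultimately have "smooth_on ?T (\<lambda>x. b ((\<phi> \<circ> inv_into V \<psi>) x) * k ((\<phi> \<circ> inv_into V \<psi>) x))"
      by (intro smooth_on_compose[OF T open_ball, where f = "\<lambda>x. b x * k x"])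
    then have "smooth_on ?T (?F \<circ> inv_into V \<psi>)"
      by (rule smooth_on_eqI[OF _ T]) (use W(2) chart_inv[OF d] in auto)
    then show ?thesis using T q True by blast
  next
    case False
    define K where "K = inv_into U \<phi> ` cball c r"
    have sub: "cball c r \<subseteq> ball c R"
      using r(1) by auto
    have "compact K"
      unfolding K_def using sub r(2) hom
      by (intro compact_continuous_image) (auto simp: homeomorphism_def intro: continuous_on_subset)
    let ?T = "\<psi> ` (V - K)"
    have T: "open ?T"
      using compact_imp_closed[OF \<open>compact K\<close>] chart_open[OF d] by (intro chart_image_open[OF d]) auto
    have "b (\<phi> z) = 0" if "z \<in> U" "z \<notin> K" for z
    proof (rule b(2))
      show "\<phi> z \<notin> ball c r"
        using that chart_inv[OF c that(1)] imageI[of "\<phi> z" "cball c r" "inv_into U \<phi>"]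
        unfolding K_def by auto
    qed
    then have "(?F \<circ> inv_into V \<psi>) x = 0" if "x \<in> ?T" for x
      using that d by auto
    then have "smooth_on ?T (?F \<circ> inv_into V \<psi>)"
      by (intro smooth_on_eqI[OF smooth_on_const T, of 0]) simp
    moreover have "q \<notin> K"
      using False sub unfolding K_def W_def by blast
    ultimately show ?thesis using T q by blast
  qed
qed

lemma tangent_add: "v \<in> TS p \<Longrightarrow> f \<in> SF \<Longrightarrow> g \<in> SF \<Longrightarrow> v (f + g) = v f + v g"
  and tangent_cmult: "v \<in> TS p \<Longrightarrow> f \<in> SF \<Longrightarrow> v (\<lambda>q. c * f q) = c * v f"
  and tangent_mult: "v \<in> TS p \<Longrightarrow> f \<in> SF \<Longrightarrow> g \<in> SF \<Longrightarrow> v (f * g) = f p * v g + g p * v f"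
  and tangent_not_smooth: "v \<in> TS p \<Longrightarrow> f \<notin> SF \<Longrightarrow> v f = 0"
  unfolding tangent_space_def by blast+

lemma tangent_0: "v \<in> TS p \<Longrightarrow> v 0 = 0"
  using tangent_cmult[of v p 0 0] by (simp add: zero_fun_def)

lemma tangent_1: "v \<in> TS p \<Longrightarrow> v 1 = 0"
  using tangent_mult[of v p 1 1] by simp

lemma tangent_uminus: "v \<in> TS p \<Longrightarrow> f \<in> SF \<Longrightarrow> v (- f) = - v f"
  using tangent_cmult[of v p f "-1"] by (simp add: fun_Compl_def)

lemma tangent_diff: "v \<in> TS p \<Longrightarrow> f \<in> SF \<Longrightarrow> g \<in> SF \<Longrightarrow> v (f - g) = v f - v g"
  using tangent_add[of v p f "- g"] by (simp add: tangent_uminus)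

lemma tangent_sum:
  "v \<in> TS p \<Longrightarrow> (\<And>i. i \<in> I \<Longrightarrow> f i \<in> SF) \<Longrightarrow> v (sum f I) = (\<Sum>i\<in>I. v (f i))"
  by (induction I rule: infinite_finite_induct) (auto simp: tangent_0 tangent_add)

lemma sum_fun_app: "sum f I x = (\<Sum>i\<in>I. f i x)"
  by (induction I rule: infinite_finite_induct) auto

text \<open>
  After this lemma, coordinates do not appear any more. The fields \<open>B i\<close> are the coordinate fields multiplied by a
  bump function \<open>u\<close>, the functions \<open>y i\<close> are the centred coordinates multiplied by \<open>u\<close>, and \<open>\<theta> = u ^ 3\<close>.
  Since \<open>\<theta>\<close> has been multiplied in, the expansion of a field in the frame is an identity on the whole
  manifold with smooth coefficients, and from here on the theory is one of modules over the smooth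
  functions. That derivations have an expansion at all is Hadamard's lemma.
\<close>

lemma local_frame:
  obtains B :: "'e \<Rightarrow> 'a vfield" and y \<theta>
  where "\<And>i. B i \<in> VF" "\<And>i. y i \<in> SF" "\<theta> \<in> SF" "\<theta> p \<noteq> 0"
    and "\<And>i j. i \<in> Basis \<Longrightarrow> j \<in> Basis \<Longrightarrow> B i p (y j) = 0 \<longleftrightarrow> i \<noteq> j"
    and "\<And>X. X \<in> VF \<Longrightarrow> \<exists>c. (\<forall>i. c i \<in> SF) \<and> fscale \<theta> X = (\<Sum>i\<in>Basis. fscale (c i) (B i))"
proof -
  obtain U \<phi> where c: "(U, \<phi>) \<in> A" and p: "p \<in> U" using chart_cover by blast
  define x0 where "x0 = \<phi> p"
  obtain R where R: "R > 0" "ball x0 R \<subseteq> \<phi> ` U"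
    using chart_open[OF c] p unfolding x0_def by (meson imageI open_contains_ball)
  obtain b :: "'e \<Rightarrow> real" where b: "smooth_on UNIV b" "b x0 \<noteq> 0" "\<And>x. x \<notin> ball x0 (R / 2) \<Longrightarrow> b x = 0"
    using exists_smooth_bump[of "R / 2" x0] R(1) by auto
  define cut where "cut k q = (if q \<in> U then b (\<phi> q) * k (\<phi> q) else 0)" for k q
  have cut: "cut k \<in> SF" if "smooth_on (ball x0 R) k" for k
    unfolding cut_def
    by (rule SF_extend_by_zero[where r = "R / 2", OF c _ R(2) b(1) _ that]) (use R(1) b(3) in auto)
  have cut_zero: "cut k q = 0" if "q \<notin> U \<or> \<phi> q \<notin> ball x0 R" for k q
    using that b(3)[of "\<phi> q"] R(1) unfolding cut_def by auto
  define u where "u = cut (\<lambda>_. 1)"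
  define y where "y j = cut (\<lambda>x. (x - x0) \<bullet> j)" for j
  \<comment> \<open>the derivative of \<open>f\<close> in the chart; \<open>b\<close> times it is smooth on the whole manifold\<close>
  define D where "D f q i = frechet_derivative (f \<circ> inv_into U \<phi>) (at (\<phi> q)) i"
    for f :: "'a \<Rightarrow> real" and q i
  define B where "B i q f = (if f \<in> SF \<and> q \<in> U then b (\<phi> q) * D f q i else 0)" for i q f
  have B_cut: "(\<lambda>q. B i q f) = cut (\<lambda>x. frechet_derivative (f \<circ> inv_into U \<phi>) (at x) i)"
    if "f \<in> SF" for f i
    using that by (auto simp: B_def cut_def D_def)
  have lin: "smooth_on (ball x0 R) (\<lambda>x. (x - a) \<bullet> j)" for a j
    using smooth_on_add[OF open_ball smooth_on_inner_const[OF open_ball, of _ _ j] smooth_on_const,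
        of x0 R "- (a \<bullet> j)"]
    by (simp add: inner_diff_left)
  have u: "u \<in> SF" and y: "y j \<in> SF" for j
    unfolding u_def y_def by (intro cut smooth_on_const lin)+
  have fder: "((f \<circ> inv_into U \<phi>) has_derivative D f q) (at (\<phi> q))" if "f \<in> SF" "q \<in> U" for f q
    using smooth_on_differentiable[OF smooth_functions_chart[OF that(1) c]] that(2)
    by (simp add: D_def[abs_def] frechet_derivative_works)
  have Deq: "D f q = f'" if "((f \<circ> inv_into U \<phi>) has_derivative f') (at (\<phi> q))" for f q f'
    using frechet_derivative_at[OF that] by (simp add: D_def[abs_def])
  have tangent: "B i q \<in> TS q" for i q
  proof (cases "q \<in> U")
    case True
    have "D (f + g) q i = D f q i + D g q i" if "f \<in> SF" "g \<in> SF" for f g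
      using Deq[of "f + g"] has_derivative_add[OF fder[OF that(1) True] fder[OF that(2) True]]
      by (simp add: o_def plus_fun_def)
    moreover have "D (\<lambda>q. r * f q) q i = r * D f q i" if "f \<in> SF" for f r
      using Deq[of "\<lambda>q. r * f q"] has_derivative_mult_right[OF fder[OF that True], of r]
      by (simp add: o_def)
    moreover have "D (f * g) q i = f q * D g q i + g q * D f q i" if "f \<in> SF" "g \<in> SF" for f g
      using Deq[of "f * g"] has_derivative_mult[OF fder[OF that(1) True] fder[OF that(2) True]]
        chart_inv[OF c True]
      by (simp add: o_def times_fun_def mult.commute)
    ultimately show ?thesis
      unfolding tangent_space_def B_def by (simp add: algebra_simps)
  qed (simp add: tangent_space_def B_def)
  have B: "B i \<in> VF" for i
    unfolding vector_fields_def deriv_along_def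
    using tangent
    by (auto simp: B_cut intro!: cut smooth_on_frechet_derivative
        smooth_on_subset[OF smooth_functions_chart[OF _ c] R(2)])
  have dual: "B i p (y j) = b x0 * (b x0 * (i \<bullet> j))" for i j
  proof -
    have "((\<lambda>x. b x * ((x - x0) \<bullet> j)) has_derivative
        (\<lambda>v. b x0 * (v \<bullet> j) + frechet_derivative b (at x0) v * ((x0 - x0) \<bullet> j))) (at x0)"
      using smooth_on_differentiable[OF b(1)]
      by (intro has_derivative_mult) (auto intro!: derivative_eq_intros simp: frechet_derivative_works[symmetric])
    then have "((\<lambda>x. b x * ((x - x0) \<bullet> j)) has_derivative (\<lambda>v. b x0 * (v \<bullet> j))) (at (\<phi> p))"
      by (simp add: x0_def)
    then have "((y j \<circ> inv_into U \<phi>) has_derivative (\<lambda>v. b x0 * (v \<bullet> j))) (at (\<phi> p))"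
    proof (rule has_derivative_transform_within_open)
      show "open (\<phi> ` U)" "\<phi> p \<in> \<phi> ` U"
        using c p chart_open by auto
      show "b x * ((x - x0) \<bullet> j) = (y j \<circ> inv_into U \<phi>) x" if "x \<in> \<phi> ` U" for x
        using c that by (auto simp: y_def cut_def)
    qed
    then show ?thesis
      using p y by (simp add: B_def Deq x0_def[symmetric])
  qed
  \<comment> \<open>The bump function need not be constant near \<open>q\<close>, so \<open>u q * v (y i) - y i q * v u\<close> takes the place of
    \<open>v (y i)\<close>: it is \<open>u\<^sup>2\<close> times the derivative of the \<open>i\<close>-th coordinate along \<open>v\<close>.\<close>
  have key: "u q ^ 3 * v f = (\<Sum>i\<in>Basis. (u q * v (y i) - y i q * v u) * B i q f)"
    if v: "v \<in> TS q" and f: "f \<in> SF" for v q f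
  proof (cases "q \<in> U \<and> \<phi> q \<in> ball x0 R")
    case False
    then show ?thesis
      using cut_zero[of q] fun_cong[OF B_cut[OF f], of _ q] by (simp add: u_def)
  next
    case True
    define a where "a = \<phi> q"
    let ?g = "f \<circ> inv_into U \<phi>"
    have a: "a \<in> ball x0 R" "?g a = f q"
      using True c by (auto simp: a_def)
    obtain h where h: "\<And>i. smooth_on (ball x0 R) (h i)" "\<And>i. h i a = frechet_derivative ?g (at a) i"
      "\<And>x. x \<in> ball x0 R \<Longrightarrow> ?g x = ?g a + (\<Sum>i\<in>Basis. ((x - a) \<bullet> i) * h i x)"
      using Hadamard[OF open_ball convex_ball a(1)
          smooth_on_subset[OF smooth_functions_chart[OF f c] R(2)]] by blast
    define e where "e i = cut (\<lambda>x. (x - a) \<bullet> i)" for i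
    define H where "H i = cut (h i)" for i
    have SF': "e i \<in> SF" "H i \<in> SF" for i
      unfolding e_def H_def by (intro cut lin h(1))+
    \<comment> \<open>Hadamard's expansion at \<open>a\<close>, with one cut-off for each of the two factors of its terms\<close>
    have "(u * u) * f = (\<lambda>z. f q * (u * u) z) + (\<Sum>i\<in>Basis. e i * H i)"
    proof
      fix z
      show "((u * u) * f) z = ((\<lambda>z. f q * (u * u) z) + (\<Sum>i\<in>Basis. e i * H i)) z"
      proof (cases "z \<in> U \<and> \<phi> z \<in> ball x0 R")
        case True
        then have "f z = f q + (\<Sum>i\<in>Basis. ((\<phi> z - a) \<bullet> i) * h i (\<phi> z))"
          using h(3)[of "\<phi> z"] a(2) c by simp
        then show ?thesis
          using True by (simp add: u_def e_def H_def cut_def sum_fun_app sum_distrib_left algebra_simps)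
      next
        case False
        then show ?thesis
          using cut_zero[of z] by (simp add: u_def e_def H_def sum_fun_app)
      qed
    qed
    note eq = this
    have eH: "e i * H i \<in> SF" for i
      by (intro SF_mult SF')
    have "v ((u * u) * f) = f q * v (u * u) + (\<Sum>i\<in>Basis. v (e i * H i))"
      by (simp only: eq tangent_add[OF v SF_cmult[OF SF_mult[OF u u]] SF_sum[OF eH]]
          tangent_cmult[OF v SF_mult[OF u u]] tangent_sum[OF v eH])
    then have uu: "u q * u q * v f = (\<Sum>i\<in>Basis. v (e i * H i))"
      using tangent_mult[OF v, of "u * u" f] u f by simp
    have "u q * v (e i * H i) = (u q * v (y i) - y i q * v u) * B i q f" for i
    proof -
      have "e i = y i + (\<lambda>z. (- ((a - x0) \<bullet> i)) * u z)"
        by (auto simp: e_def y_def u_def cut_def algebra_simps)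
      then have ve: "v (e i) = v (y i) + (- ((a - x0) \<bullet> i)) * v u"
        using tangent_add[OF v] tangent_cmult[OF v] u y SF_cmult by metis
      have eq': "e i q = 0" "H i q = B i q f" and yq: "y i q = ((a - x0) \<bullet> i) * u q"
        using True f h(2) by (auto simp: e_def y_def u_def H_def cut_def B_def D_def a_def)
      have ve': "v (e i * H i) = B i q f * v (e i)"
        using tangent_mult[OF v SF', of i i] eq' by simp
      show ?thesis
        unfolding ve' ve yq by (simp add: algebra_simps)
    qed
    then show ?thesis
      using arg_cong[OF uu, of "\<lambda>t. u q * t"] by (simp add: sum_distrib_left power3_eq_cube mult.assoc)
  qed
  show thesis
  proof
    show "B i \<in> VF" "y i \<in> SF" "u * u * u \<in> SF" for i
      using B y u by auto
    show "(u * u * u) p \<noteq> 0"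
      using b(2) p by (simp add: u_def cut_def x0_def)
    show "B i p (y j) = 0 \<longleftrightarrow> i \<noteq> j" if "i \<in> Basis" "j \<in> Basis" for i j
      using dual[of i j] b(2) that by (simp add: inner_Basis)
    fix X assume X: "X \<in> VF"
    define k where "k i = u * deriv_along X (y i) - y i * deriv_along X u" for i
    have "k i \<in> SF" for i
      using X u y by (auto simp: k_def vector_fields_def)
    moreover have "fscale (u * u * u) X = (\<Sum>i\<in>Basis. fscale (k i) (B i))"
    proof (intro ext)
      fix q f
      show "fscale (u * u * u) X q f = (\<Sum>i\<in>Basis. fscale (k i) (B i)) q f"
      proof (cases "f \<in> SF")
        case True
        then show ?thesis
          using key[of "X q" q f] X
          by (simp add: sum_fun_app fscale_def tscale_def k_def deriv_along_def vector_fields_def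
              power3_eq_cube)
      next
        case False
        then show ?thesis
          using X tangent_not_smooth[of "X q" q f]
          by (simp add: sum_fun_app fscale_def tscale_def B_def vector_fields_def)
      qed
    qed
    ultimately show "\<exists>c. (\<forall>i. c i \<in> SF) \<and> fscale (u * u * u) X = (\<Sum>i\<in>Basis. fscale (c i) (B i))"
      by blast
  qed
qed

end

section \<open>The module of vector fields\<close>

lemma fscale_add_right: "fscale f (X + Y) = fscale f X + fscale f Y"
  and fscale_diff_right: "fscale f (X - Y) = fscale f X - fscale f Y"
  and fscale_minus_right: "fscale f (- X) = - fscale f X"
  and fscale_add_left: "fscale (f + g) X = fscale f X + fscale g X"
  and fscale_diff_left: "fscale (f - g) X = fscale f X - fscale g X"
  and fscale_minus_left: "fscale (- f) X = - fscale f X"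
  and fscale_fscale: "fscale f (fscale g X) = fscale (f * g) X"
  and fscale_1: "fscale 1 X = X"
  and fscale_0_left: "fscale 0 X = 0"
  and fscale_0_right: "fscale f 0 = 0"
  by (intro ext; simp add: fscale_def tscale_def algebra_simps)+

lemmas fscale_simps = fscale_add_right fscale_diff_right fscale_minus_right fscale_add_left
  fscale_diff_left fscale_minus_left fscale_fscale fscale_1 fscale_0_left fscale_0_right

lemma deriv_along_add_left: "deriv_along (X + Y) f = deriv_along X f + deriv_along Y f"
  and deriv_along_diff_left: "deriv_along (X - Y) f = deriv_along X f - deriv_along Y f"
  and deriv_along_minus_left: "deriv_along (- X) f = - deriv_along X f"
  and deriv_along_0_left: "deriv_along 0 f = 0"
  and deriv_along_fscale: "deriv_along (fscale g X) f = g * deriv_along X f"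
  and deriv_along_lie_bracket: "deriv_along (lie_bracket X Y) f =
    deriv_along X (deriv_along Y f) - deriv_along Y (deriv_along X f)"
  by (intro ext; simp add: deriv_along_def fscale_def tscale_def lie_bracket_def)+

lemmas deriv_along_left_simps = deriv_along_add_left deriv_along_diff_left deriv_along_minus_left
  deriv_along_0_left deriv_along_fscale deriv_along_lie_bracket

lemma lie_bracket_antisym: "lie_bracket Y X = - lie_bracket X Y"
  by (intro ext) (simp add: lie_bracket_def)

lemma lie_bracket_self: "lie_bracket X X = 0"
  by (intro ext) (simp add: lie_bracket_def)

context manifold
begin

lemma VF_tangent: "X \<in> VF \<Longrightarrow> X p \<in> TS p"
  by (simp add: vector_fields_def)

lemma SF_deriv_along [simp]: "X \<in> VF \<Longrightarrow> f \<in> SF \<Longrightarrow> deriv_along X f \<in> SF"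
  by (simp add: vector_fields_def)

lemma deriv_along_add: "X \<in> VF \<Longrightarrow> f \<in> SF \<Longrightarrow> g \<in> SF \<Longrightarrow>
    deriv_along X (f + g) = deriv_along X f + deriv_along X g"
  and deriv_along_diff: "X \<in> VF \<Longrightarrow> f \<in> SF \<Longrightarrow> g \<in> SF \<Longrightarrow>
    deriv_along X (f - g) = deriv_along X f - deriv_along X g"
  and deriv_along_minus: "X \<in> VF \<Longrightarrow> f \<in> SF \<Longrightarrow> deriv_along X (- f) = - deriv_along X f"
  and deriv_along_mult: "X \<in> VF \<Longrightarrow> f \<in> SF \<Longrightarrow> g \<in> SF \<Longrightarrow>
    deriv_along X (f * g) = f * deriv_along X g + g * deriv_along X f"
  and deriv_along_0: "X \<in> VF \<Longrightarrow> deriv_along X 0 = 0"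
  and deriv_along_1: "X \<in> VF \<Longrightarrow> deriv_along X 1 = 0"
  using VF_tangent
  by (simp_all add: fun_eq_iff deriv_along_def tangent_add[OF VF_tangent] tangent_diff[OF VF_tangent]
      tangent_uminus[OF VF_tangent] tangent_mult[OF VF_tangent] tangent_0[OF VF_tangent]
      tangent_1[OF VF_tangent])

lemmas deriv_along_simps = deriv_along_add deriv_along_diff deriv_along_minus deriv_along_mult
  deriv_along_0 deriv_along_1 deriv_along_left_simps

lemma VF_not_smooth: "X \<in> VF \<Longrightarrow> f \<notin> SF \<Longrightarrow> X p f = 0"
  using VF_tangent tangent_not_smooth by blast

lemma VF_eqI:
  assumes "X \<in> VF" "Y \<in> VF" "\<And>f. f \<in> SF \<Longrightarrow> deriv_along X f = deriv_along Y f"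
  shows "X = Y"
proof (intro ext)
  fix p f
  show "X p f = Y p f"
    using assms(3)[of f] VF_not_smooth[OF assms(1)] VF_not_smooth[OF assms(2)]
    by (cases "f \<in> SF") (auto simp: deriv_along_def fun_eq_iff)
qed

lemma TS_I:
  assumes "\<And>f g. f \<in> SF \<Longrightarrow> g \<in> SF \<Longrightarrow> v (f + g) = v f + v g"
    and "\<And>f c. f \<in> SF \<Longrightarrow> v (\<lambda>q. c * f q) = c * v f"
    and "\<And>f g. f \<in> SF \<Longrightarrow> g \<in> SF \<Longrightarrow> v (f * g) = f p * v g + g p * v f"
    and "\<And>f. f \<notin> SF \<Longrightarrow> v f = 0"
  shows "v \<in> TS p"
  using assms by (simp add: tangent_space_def)

lemma TS_add: "v \<in> TS p \<Longrightarrow> w \<in> TS p \<Longrightarrow> v + w \<in> TS p"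
  by (rule TS_I)
    (simp_all add: tangent_add tangent_cmult tangent_mult tangent_not_smooth algebra_simps)

lemma TS_tscale: "v \<in> TS p \<Longrightarrow> tscale c v \<in> TS p"
  by (rule TS_I)
    (simp_all add: tscale_def tangent_add tangent_cmult tangent_mult tangent_not_smooth algebra_simps)

lemma VF_I:
  "(\<And>p. X p \<in> TS p) \<Longrightarrow> (\<And>f. f \<in> SF \<Longrightarrow> deriv_along X f \<in> SF) \<Longrightarrow> X \<in> VF"
  unfolding vector_fields_def by blast

lemma VF_add [simp]: "X \<in> VF \<Longrightarrow> Y \<in> VF \<Longrightarrow> X + Y \<in> VF"
  by (rule VF_I) (simp_all add: TS_add VF_tangent deriv_along_simps)

lemma VF_fscale [simp]: "f \<in> SF \<Longrightarrow> X \<in> VF \<Longrightarrow> fscale f X \<in> VF"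
  by (rule VF_I) (simp_all add: TS_tscale VF_tangent deriv_along_simps, simp add: fscale_def TS_tscale VF_tangent)

lemma VF_minus [simp]: "X \<in> VF \<Longrightarrow> - X \<in> VF"
  using VF_fscale[of "-1" X] by (simp add: fscale_simps)

lemma VF_diff [simp]: "X \<in> VF \<Longrightarrow> Y \<in> VF \<Longrightarrow> X - Y \<in> VF"
  using VF_add[of X "- Y"] by simp

lemma VF_0 [simp]: "0 \<in> VF"
  by (rule VF_I) (simp_all add: tangent_space_def deriv_along_simps)

lemma VF_sum [simp]: "(\<And>i. i \<in> I \<Longrightarrow> X i \<in> VF) \<Longrightarrow> sum X I \<in> VF"
  by (induction I rule: infinite_finite_induct) auto

lemma VF_lie_bracket [simp]:
  assumes "X \<in> VF" "Y \<in> VF"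
  shows "lie_bracket X Y \<in> VF"
proof (rule VF_I)
  fix p
  show "lie_bracket X Y p \<in> TS p"
  proof (rule TS_I)
    have eq: "lie_bracket X Y p f = deriv_along X (deriv_along Y f) p - deriv_along Y (deriv_along X f) p" for f
      by (simp add: lie_bracket_def deriv_along_def)
    have cm: "deriv_along Z (\<lambda>q. c * f q) = (\<lambda>q. c * deriv_along Z f q)" if "Z \<in> VF" "f \<in> SF" for Z c f
      using tangent_cmult[OF VF_tangent[OF that(1)] that(2)] by (auto simp: deriv_along_def)
    fix f g :: "'a \<Rightarrow> real" and c :: real
    show "lie_bracket X Y p f = 0" if "f \<notin> SF"
    proof -
      have "deriv_along X f = 0" "deriv_along Y f = 0"
        using assms that VF_not_smooth by (auto simp: deriv_along_def)
      then show ?thesis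
        using assms by (simp add: eq deriv_along_simps)
    qed
    assume f: "f \<in> SF"
    show "lie_bracket X Y p (\<lambda>q. c * f q) = c * lie_bracket X Y p f"
      using assms f by (simp add: eq cm algebra_simps)
    assume g: "g \<in> SF"
    show "lie_bracket X Y p (f + g) = lie_bracket X Y p f + lie_bracket X Y p g"
      using assms f g by (simp add: eq deriv_along_simps)
    show "lie_bracket X Y p (f * g) = f p * lie_bracket X Y p g + g p * lie_bracket X Y p f"
      using assms f g by (simp add: eq deriv_along_simps algebra_simps)
  qed
qed (use assms in \<open>simp add: deriv_along_simps\<close>)

lemma lie_bracket_add_left: "X \<in> VF \<Longrightarrow> Y \<in> VF \<Longrightarrow> Z \<in> VF \<Longrightarrow>
    lie_bracket (X + Y) Z = lie_bracket X Z + lie_bracket Y Z"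
  and lie_bracket_add_right: "X \<in> VF \<Longrightarrow> Y \<in> VF \<Longrightarrow> Z \<in> VF \<Longrightarrow>
    lie_bracket X (Y + Z) = lie_bracket X Y + lie_bracket X Z"
  and lie_bracket_diff_right: "X \<in> VF \<Longrightarrow> Y \<in> VF \<Longrightarrow> Z \<in> VF \<Longrightarrow>
    lie_bracket X (Y - Z) = lie_bracket X Y - lie_bracket X Z"
  and lie_bracket_minus_left: "X \<in> VF \<Longrightarrow> Y \<in> VF \<Longrightarrow> lie_bracket (- X) Y = - lie_bracket X Y"
  and lie_bracket_minus_right: "X \<in> VF \<Longrightarrow> Y \<in> VF \<Longrightarrow> lie_bracket X (- Y) = - lie_bracket X Y"
  and lie_bracket_fscale_left: "X \<in> VF \<Longrightarrow> Y \<in> VF \<Longrightarrow> f \<in> SF \<Longrightarrow>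
    lie_bracket (fscale f X) Y = fscale f (lie_bracket X Y) - fscale (deriv_along Y f) X"
  and lie_bracket_fscale_right: "X \<in> VF \<Longrightarrow> Y \<in> VF \<Longrightarrow> f \<in> SF \<Longrightarrow>
    lie_bracket X (fscale f Y) = fscale f (lie_bracket X Y) + fscale (deriv_along X f) Y"
  and Jacobi: "X \<in> VF \<Longrightarrow> Y \<in> VF \<Longrightarrow> Z \<in> VF \<Longrightarrow> lie_bracket X (lie_bracket Y Z) =
    lie_bracket (lie_bracket X Y) Z + lie_bracket Y (lie_bracket X Z)"
  by (rule VF_eqI; simp add: deriv_along_simps algebra_simps)+

lemmas lie_bracket_simps = lie_bracket_add_left lie_bracket_add_right lie_bracket_diff_right
  lie_bracket_minus_left lie_bracket_minus_right lie_bracket_fscale_left lie_bracket_fscale_right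

text \<open>
  The quotients \<open>W p / u p\<close>, defined near \<open>p\<close>, agree by the compatibility condition. Their common value
  is smooth by local division.
\<close>

lemma VF_glue:
  assumes W: "\<And>p. W p \<in> VF" and u: "\<And>p. u p \<in> SF" "\<And>p. u p p \<noteq> 0"
    and compat: "\<And>p q. fscale (u q) (W p) = fscale (u p) (W q)"
  obtains X where "X \<in> VF" "\<And>p. fscale (u p) X = W p"
proof
  define X where "X q = tscale (1 / u q q) (W q q)" for q
  show eq: "fscale (u p) X = W p" for p
  proof (intro ext)
    fix q f
    have "u q q * W p q f = u p q * W q q f"
      using fun_cong[OF fun_cong[OF compat[of q p]], of q f] by (simp add: fscale_def tscale_def)
    then show "fscale (u p) X q f = W p q f"
      using u(2)[of q] by (simp add: fscale_def tscale_def X_def divide_simps mult_ac)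
  qed
  show "X \<in> VF"
  proof (rule VF_I)
    show "X p \<in> TS p" for p
      unfolding X_def by (rule TS_tscale) (rule VF_tangent[OF W])
    show "deriv_along X f \<in> SF" if "f \<in> SF" for f
    proof (rule SF_local_division)
      fix p
      have "u p * deriv_along X f = deriv_along (W p) f"
        by (simp only: eq[symmetric] deriv_along_fscale)
      then show "\<exists>u\<in>SF. u p \<noteq> 0 \<and> u * deriv_along X f \<in> SF"
        using u W that by (metis SF_deriv_along)
    qed
  qed
qed

text \<open>
  Linearity over the smooth functions: these are the one-forms, viewed on global vector fields.
\<close>

definition functional :: "('a vfield \<Rightarrow> 'a \<Rightarrow> real) \<Rightarrow> bool" where
  "functional F \<longleftrightarrow> (\<forall>X\<in>VF. F X \<in> SF \<and> (\<forall>Y\<in>VF. F (X + Y) = F X + F Y) \<and>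
    (\<forall>f\<in>SF. F (fscale f X) = f * F X))"

lemma functional_sum:
  assumes F: "functional F" and "\<And>i. X i \<in> VF" "\<And>i. c i \<in> SF"
  shows "F (\<Sum>i\<in>I. fscale (c i) (X i)) = (\<Sum>i\<in>I. c i * F (X i))"
proof -
  have add: "F (Y + Z) = F Y + F Z" if "Y \<in> VF" "Z \<in> VF" for Y Z
    using F that unfolding functional_def by blast
  have scale: "F (fscale f Y) = f * F Y" if "f \<in> SF" "Y \<in> VF" for f Y
    using F that unfolding functional_def by blast
  have "F 0 = 0"
    using scale[OF SF_0 VF_0] by (simp only: fscale_0_left mult_zero_left)
  then show ?thesis
    by (induction I rule: infinite_finite_induct) (simp_all add: add scale assms(2,3))
qed

text \<open>
  Tensoriality: if \<open>X\<close> vanishes at \<open>p\<close>, then so do its coefficients in a local frame, as the functions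
  dual to the frame show.
\<close>

lemma functional_at_zero:
  assumes F: "functional F" and X: "X \<in> VF" "X p = 0"
  shows "F X p = 0"
proof -
  obtain B :: "'e \<Rightarrow> 'a vfield" and y \<theta>
    where B: "\<And>i. B i \<in> VF" and y: "\<And>i. y i \<in> SF" and \<theta>: "\<theta> \<in> SF" "\<theta> p \<noteq> 0"
    and dual: "\<And>i j. i \<in> Basis \<Longrightarrow> j \<in> Basis \<Longrightarrow> B i p (y j) = 0 \<longleftrightarrow> i \<noteq> j"
    and frame: "\<And>X. X \<in> VF \<Longrightarrow>
        \<exists>c. (\<forall>i. c i \<in> SF) \<and> fscale \<theta> X = (\<Sum>i\<in>Basis. fscale (c i) (B i))"
    by (rule local_frame[of p]) (rule that)
  obtain c where c: "\<And>i. c i \<in> SF" "fscale \<theta> X = (\<Sum>i\<in>Basis. fscale (c i) (B i))"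
    using frame[OF X(1)] by blast
  have c0: "c j p = 0" if j: "j \<in> Basis" for j
  proof -
    have "0 = (\<Sum>i\<in>Basis. c i p * B i p (y j))"
      using fun_cong[OF fun_cong[OF c(2), of p], of "y j"] X(2)
      by (simp add: fscale_def tscale_def sum_fun_app)
    also have "\<dots> = (\<Sum>i\<in>{j}. c i p * B i p (y j))"
      using j dual by (intro sum.mono_neutral_right) auto
    finally show ?thesis
      using dual[OF j j] by simp
  qed
  have "\<theta> * F X = F (fscale \<theta> X)"
    using F X \<theta> by (simp add: functional_def)
  also have "\<dots> = (\<Sum>i\<in>Basis. c i * F (B i))"
    unfolding c(2) by (rule functional_sum[OF F B c(1)])
  finally have "\<theta> p * F X p = (\<Sum>i\<in>Basis. c i p * F (B i) p)"
    by (simp add: fun_eq_iff sum_fun_app)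
  then show ?thesis
    using c0 \<theta>(2) by simp
qed

text \<open>
  Gram-Schmidt without normalization. For the span of a part \<open>I\<close> of a local frame, the equations
  \<open>h W (B i) = u * c i\<close> are solved for all right-hand sides at once, with a common denominator \<open>u\<close> that
  does not vanish at \<open>p\<close>. To adjoin \<open>B k\<close>, subtract from \<open>u * B k\<close> the combination \<open>C\<close> of the earlier
  \<open>B i\<close> that has the same pairings with them; the difference \<open>e\<close> is orthogonal to them and nonzero at \<open>p\<close> by independence of
  the frame, and adding a multiple of \<open>e\<close> to the old solution adjusts the pairing with \<open>B k\<close> alone.
\<close>

lemma local_Riesz:
  assumes h: "\<And>X. X \<in> VF \<Longrightarrow> functional (h X)"
    and sym: "\<And>X Y. X \<in> VF \<Longrightarrow> Y \<in> VF \<Longrightarrow> h X Y = h Y X"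
    and definite: "\<And>X. X \<in> VF \<Longrightarrow> X p \<noteq> 0 \<Longrightarrow> h X X p \<noteq> 0"
  obtains u where "u \<in> SF" "u p \<noteq> 0"
    and "\<And>F. functional F \<Longrightarrow> \<exists>W\<in>VF. \<forall>X\<in>VF. h W X = u * F X"
proof -
  have h_SF [simp]: "h X Y \<in> SF"
    and h_add [simp]: "Z \<in> VF \<Longrightarrow> h X (Y + Z) = h X Y + h X Z"
    and h_fscale [simp]: "f \<in> SF \<Longrightarrow> h X (fscale f Y) = f * h X Y"
    if "X \<in> VF" "Y \<in> VF" for X Y Z f
    using h[OF that(1)] that unfolding functional_def by auto
  have h_minus [simp]: "h X (- Y) = - h X Y" if "X \<in> VF" "Y \<in> VF" for X Y
    using h_fscale[OF that, of "-1"] by (simp add: fscale_simps)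
  have h_diff [simp]: "h X (Y - Z) = h X Y - h X Z" if "X \<in> VF" "Y \<in> VF" "Z \<in> VF" for X Y Z
    using h_add[OF that(1,2), of "- Z"] that by simp
  have h_left [simp]: "h (X + Y) Z = h X Z + h Y Z" "h (X - Y) Z = h X Z - h Y Z"
    "f \<in> SF \<Longrightarrow> h (fscale f X) Z = f * h X Z"
    if "X \<in> VF" "Y \<in> VF" "Z \<in> VF" for X Y Z f
    using that by (simp_all add: sym[of _ Z])
  obtain B :: "'e \<Rightarrow> 'a vfield" and y \<theta>
    where B: "\<And>i. B i \<in> VF" and y: "\<And>i. y i \<in> SF" and \<theta>: "\<theta> \<in> SF" "\<theta> p \<noteq> 0"
    and dual: "\<And>i j. i \<in> Basis \<Longrightarrow> j \<in> Basis \<Longrightarrow> B i p (y j) = 0 \<longleftrightarrow> i \<noteq> j"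
    and frame: "\<And>X. X \<in> VF \<Longrightarrow>
        \<exists>c. (\<forall>i. c i \<in> SF) \<and> fscale \<theta> X = (\<Sum>i\<in>Basis. fscale (c i) (B i))"
    by (rule local_frame[of p]) (rule that)
  \<comment> \<open>The two properties of the span of the \<open>B i\<close> with \<open>i \<in> I\<close> that the induction needs: the dual functions
    with other indices do not see it at \<open>p\<close>, and what is orthogonal to the \<open>B i\<close> is orthogonal to it.\<close>
  define S where "S I = {W \<in> VF. (\<forall>j\<in>Basis - I. W p (y j) = 0) \<and>
      (\<forall>X\<in>VF. (\<forall>i\<in>I. h X (B i) = 0) \<longrightarrow> h X W = 0)}" for I
  have solve: "\<exists>u\<in>SF. u p \<noteq> 0 \<and>
      (\<forall>c. (\<forall>i. c i \<in> SF) \<longrightarrow> (\<exists>W\<in>S I. \<forall>i\<in>I. h W (B i) = u * c i))"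
    if "finite I" "I \<subseteq> Basis" for I
    using that
  proof (induction I rule: finite_induct)
    case empty
    have "h X 0 = 0" if "X \<in> VF" for X
      using h_fscale[OF that VF_0 SF_0] by (simp add: fscale_simps)
    then have "0 \<in> S {}"
      by (simp add: S_def)
    then show ?case
      by (intro bexI[of _ 1]) auto
  next
    case (insert k I)
    obtain u where u: "u \<in> SF" "u p \<noteq> 0"
      and solve: "\<And>c. (\<And>i. c i \<in> SF) \<Longrightarrow> \<exists>W\<in>S I. \<forall>i\<in>I. h W (B i) = u * c i"
      using insert.IH insert.prems by blast
    obtain C where C: "C \<in> S I" "\<And>i. i \<in> I \<Longrightarrow> h C (B i) = u * h (B k) (B i)"
      using solve[of "\<lambda>i. h (B k) (B i)"] B by auto
    define e where "e = fscale u (B k) - C"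
    have VF: "C \<in> VF" "e \<in> VF"
      using C B u by (simp_all add: S_def e_def)
    have e0: "h e (B i) = 0" if "i \<in> I" for i
      using that C B u VF(1) by (simp add: e_def)
    have "h e C = 0"
      using C(1) e0 VF(2) by (simp add: S_def)
    then have ek: "u * h e (B k) = h e e"
      using B u VF h_diff[of e "fscale u (B k)" C] by (simp add: e_def[symmetric])
    have "e p (y k) = u p * B k p (y k)"
      using C(1) insert.hyps insert.prems by (simp add: e_def fscale_def tscale_def S_def)
    then have "e p \<noteq> 0"
      using dual[of k k] u(2) insert.prems by auto
    then have ee: "h e e p \<noteq> 0"
      using definite VF(2) by blast
    show ?case
    proof (intro bexI[of _ "u * h e e"] conjI allI impI)
      fix c :: "'e \<Rightarrow> 'a \<Rightarrow> real"
      assume c: "\<forall>i. c i \<in> SF"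
      then obtain W where W: "W \<in> S I" "\<And>i. i \<in> I \<Longrightarrow> h W (B i) = u * c i"
        using solve by blast
      then have WV: "W \<in> VF" by (simp add: S_def)
      \<comment> \<open>the coefficient of \<open>e\<close> in the new solution, in view of \<open>u * h e (B k) = h e e\<close>\<close>
      define a where "a = u * (u * c k - h W (B k))"
      have a: "a \<in> SF" using u c B WV by (simp add: a_def)
      define W' where "W' = fscale (h e e) W + fscale a e"
      have hW': "h X W' = h e e * h X W + a * h X e" if "X \<in> VF" for X
        using that a WV VF by (simp add: W'_def)
      have W'V: "W' \<in> VF"
        using a WV VF by (simp add: W'_def)
      have "h X W' = 0" if "X \<in> VF" "\<forall>i\<in>insert k I. h X (B i) = 0" for X
      proof -
        have "h X C = 0" "h X W = 0"
          using that C(1) W(1) by (simp_all add: S_def)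
        moreover have "h X e = u * h X (B k) - h X C"
          using that(1) B u VF(1) by (simp add: e_def)
        ultimately show ?thesis
          using hW'[OF that(1)] that(2) by simp
      qed
      moreover have "W' p (y j) = 0" if "j \<in> Basis - insert k I" for j
        using that W(1) C(1) dual[of k j] insert.prems
        by (auto simp: W'_def e_def fscale_def tscale_def S_def)
      ultimately have "W' \<in> S (insert k I)"
        using W'V by (auto simp: S_def)
      moreover have "h W' (B i) = u * h e e * c i" if "i \<in> insert k I" for i
      proof -
        have eq: "h W' (B i) = h e e * h W (B i) + a * h e (B i)"
          using B a WV VF by (simp add: W'_def)
        show ?thesis
        proof (cases "i = k")
          case True
          have "a * h e (B k) = (u * c k - h W (B k)) * (u * h e (B k))"
            by (simp add: a_def algebra_simps)
          then show ?thesis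
            using eq True ek by (simp add: algebra_simps)
        next
          case False
          then show ?thesis
            using eq that e0 W(2) by (simp add: algebra_simps)
        qed
      qed
      ultimately show "\<exists>W\<in>S (insert k I). \<forall>i\<in>insert k I. h W (B i) = u * h e e * c i"
        by blast
    qed (use u ee VF in auto)
  qed
  obtain u where u: "u \<in> SF" "u p \<noteq> 0"
    and solve: "\<And>c. (\<And>i. c i \<in> SF) \<Longrightarrow> \<exists>W\<in>S Basis. \<forall>i\<in>Basis. h W (B i) = u * c i"
    using solve[OF finite_Basis order_refl] by blast
  show thesis
  proof
    show "u * \<theta> \<in> SF" "(u * \<theta>) p \<noteq> 0"
      using u \<theta> by auto
    fix F assume F: "functional F"
    then have F_SF: "F X \<in> SF" if "X \<in> VF" for X
      using that by (simp add: functional_def)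
    obtain W where W: "W \<in> VF" "\<And>i. i \<in> Basis \<Longrightarrow> h W (B i) = u * F (B i)"
      using solve[of "\<lambda>i. F (B i)"] F_SF B by (auto simp: S_def)
    have "h (fscale \<theta> W) X = u * \<theta> * F X" if X: "X \<in> VF" for X
    proof -
      obtain c where c: "\<And>i. c i \<in> SF" "fscale \<theta> X = (\<Sum>i\<in>Basis. fscale (c i) (B i))"
        using frame[OF X] by blast
      have "h (fscale \<theta> W) X = h W (fscale \<theta> X)"
        using W X \<theta> by simp
      also have "\<dots> = (\<Sum>i\<in>Basis. c i * h W (B i))"
        unfolding c(2) by (rule functional_sum[OF h[OF W(1)] B c(1)])
      also have "\<dots> = u * (\<Sum>i\<in>Basis. c i * F (B i))"
        using W(2) by (simp add: sum_distrib_left mult_ac)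
      also have "(\<Sum>i\<in>Basis. c i * F (B i)) = F (fscale \<theta> X)"
        unfolding c(2) by (rule functional_sum[OF F B c(1), symmetric])
      also have "\<dots> = \<theta> * F X"
        using F X \<theta> by (simp add: functional_def)
      finally show ?thesis by (simp only: mult_ac)
    qed
    then show "\<exists>W\<in>VF. \<forall>X\<in>VF. h W X = u * \<theta> * F X"
      using W \<theta> by (intro bexI[of _ "fscale \<theta> W"]) auto
  qed
qed

end

section \<open>Contact triads and the Reeb field\<close>

locale triad = manifold A
  for A :: "('a::{t2_space,second_countable_topology}, 'e::euclidean_space) atlas" +
  fixes n :: nat and lam :: "'a \<Rightarrow> 'a tvec \<Rightarrow> real" and J :: "'a \<Rightarrow> 'a tvec \<Rightarrow> 'a tvec"
  assumes triad: "contact_triad A n lam J"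
begin

abbreviation "CS \<equiv> contact_sections A lam"
abbreviation "L X \<equiv> lam \<cdot> X"
abbreviation "\<omega> \<equiv> ext_deriv lam"
abbreviation "h Y Z \<equiv> \<omega> Y (J \<cdot> Z)"

lemma one_form: "one_form A lam"
  using triad unfolding contact_triad_def contact_form_def by blast

lemma L_SF [simp]: "X \<in> VF \<Longrightarrow> L X \<in> SF"
  using one_form unfolding one_form_def by blast

lemma L_add: "X \<in> VF \<Longrightarrow> Y \<in> VF \<Longrightarrow> L (X + Y) = L X + L Y"
  using one_form unfolding one_form_def by (simp add: at_points_def fun_eq_iff VF_tangent)

lemma L_fscale: "X \<in> VF \<Longrightarrow> L (fscale f X) = f * L X"
  using one_form unfolding one_form_def by (simp add: at_points_def fun_eq_iff VF_tangent fscale_def)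

lemma L_minus: "X \<in> VF \<Longrightarrow> L (- X) = - L X"
  using L_fscale[of X "-1"] by (simp add: fscale_simps)

lemma L_diff: "X \<in> VF \<Longrightarrow> Y \<in> VF \<Longrightarrow> L (X - Y) = L X - L Y"
  using L_add[of X "- Y"] by (simp add: L_minus)

lemma L_0: "L 0 = 0"
  using L_fscale[of 0 0] by (simp add: fscale_simps)

lemmas L_simps = L_add L_fscale L_minus L_diff L_0

lemma CS_iff: "Y \<in> CS \<longleftrightarrow> Y \<in> VF \<and> L Y = 0"
  by (auto simp: contact_sections_def contact_space_def VF_tangent at_points_def fun_eq_iff)

lemma CS_VF [simp]: "Y \<in> CS \<Longrightarrow> Y \<in> VF" and L_CS: "Y \<in> CS \<Longrightarrow> L Y = 0"
  by (simp_all add: CS_iff)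

lemma CS_add [simp]: "X \<in> CS \<Longrightarrow> Y \<in> CS \<Longrightarrow> X + Y \<in> CS"
  and CS_diff [simp]: "X \<in> CS \<Longrightarrow> Y \<in> CS \<Longrightarrow> X - Y \<in> CS"
  and CS_minus [simp]: "X \<in> CS \<Longrightarrow> - X \<in> CS"
  and CS_fscale [simp]: "X \<in> CS \<Longrightarrow> f \<in> SF \<Longrightarrow> fscale f X \<in> CS"
  and CS_0 [simp]: "0 \<in> CS"
  by (simp_all add: CS_iff L_simps)

lemma CS_point: "Y \<in> CS \<Longrightarrow> Y p \<in> contact_space A lam p"
  unfolding contact_sections_def by blast

lemma
  shows J_point: "\<forall>v\<in>contact_space A lam p.
      J p v \<in> contact_space A lam p \<and> J p (J p v) = - v \<and>
      (\<forall>\<omega>\<in>contact_space A lam p. J p (v + \<omega>) = J p v + J p \<omega>) \<and>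
      (\<forall>c. J p (tscale c v) = tscale c (J p v))" (is "?J p")
    and J_CS [simp]: "Y \<in> CS \<Longrightarrow> J \<cdot> Y \<in> CS"
    and omega_J_J: "Y \<in> CS \<Longrightarrow> Z \<in> CS \<Longrightarrow> \<omega> (J \<cdot> Y) (J \<cdot> Z) = \<omega> Y Z"
    and h_pos: "Y \<in> CS \<Longrightarrow> Y p \<noteq> 0 \<Longrightarrow> h Y Y p > 0"
proof -
  have J_lin: "\<forall>p. ?J p"
    using triad unfolding contact_triad_def by (elim conjE) assumption
  have J_closed: "\<forall>Y\<in>CS. J \<cdot> Y \<in> CS"
    using triad unfolding contact_triad_def by (elim conjE) assumption
  have J_inv: "\<forall>Y\<in>CS. \<forall>Z\<in>CS. \<omega> (J \<cdot> Y) (J \<cdot> Z) = \<omega> Y Z"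
    using triad unfolding contact_triad_def by (elim conjE) assumption
  have J_pos: "\<forall>Y\<in>CS. \<forall>p. Y p \<noteq> 0 \<longrightarrow> 0 < h Y Y p"
    using triad unfolding contact_triad_def by (elim conjE) assumption
  show "?J p" by (rule spec[OF J_lin])
  show "J \<cdot> Y \<in> CS" if "Y \<in> CS" by (rule bspec[OF J_closed that])
  show "\<omega> (J \<cdot> Y) (J \<cdot> Z) = \<omega> Y Z" if "Y \<in> CS" "Z \<in> CS"
    by (rule bspec[OF bspec[OF J_inv that(1)] that(2)])
  show "h Y Y p > 0" if "Y \<in> CS" "Y p \<noteq> 0"
    by (rule mp[OF spec[OF bspec[OF J_pos that(1)]] that(2)])
qed

lemma J_add: "X \<in> CS \<Longrightarrow> Y \<in> CS \<Longrightarrow> J \<cdot> (X + Y) = J \<cdot> X + J \<cdot> Y"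
  and J_fscale: "X \<in> CS \<Longrightarrow> J \<cdot> fscale f X = fscale f (J \<cdot> X)"
  and J_J: "X \<in> CS \<Longrightarrow> J \<cdot> J \<cdot> X = - X"
  using J_point CS_point[of X] CS_point[of Y] by (simp_all add: at_points_def fscale_def fun_eq_iff)

lemma J_minus: "X \<in> CS \<Longrightarrow> J \<cdot> (- X) = - (J \<cdot> X)"
  using J_fscale[of X "-1"] by (simp add: fscale_simps)

lemma J_diff: "X \<in> CS \<Longrightarrow> Y \<in> CS \<Longrightarrow> J \<cdot> (X - Y) = J \<cdot> X - J \<cdot> Y"
  using J_add[of X "- Y"] by (simp add: J_minus)

lemma J_0: "J \<cdot> 0 = 0"
  using J_fscale[of 0 0] by (simp add: fscale_simps)

lemmas J_simps = J_add J_fscale J_J J_minus J_diff J_0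

lemma omega_SF [simp]: "X \<in> VF \<Longrightarrow> Y \<in> VF \<Longrightarrow> \<omega> X Y \<in> SF"
  by (simp add: ext_deriv_def)

lemma omega_antisym: "X \<in> VF \<Longrightarrow> Y \<in> VF \<Longrightarrow> \<omega> X Y = - \<omega> Y X"
  using lie_bracket_antisym[of X Y] by (simp add: ext_deriv_def L_minus)

lemma omega_self: "X \<in> VF \<Longrightarrow> \<omega> X X = 0"
  by (simp add: ext_deriv_def lie_bracket_self L_0)

lemma omega_add_right: "X \<in> VF \<Longrightarrow> Y \<in> VF \<Longrightarrow> Z \<in> VF \<Longrightarrow> \<omega> X (Y + Z) = \<omega> X Y + \<omega> X Z"
  by (simp add: ext_deriv_def L_simps lie_bracket_simps deriv_along_simps)

lemma omega_fscale_right: "X \<in> VF \<Longrightarrow> Y \<in> VF \<Longrightarrow> f \<in> SF \<Longrightarrow> \<omega> X (fscale f Y) = f * \<omega> X Y"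
  by (simp add: ext_deriv_def L_simps lie_bracket_simps deriv_along_simps algebra_simps)

lemma omega_minus_right: "X \<in> VF \<Longrightarrow> Y \<in> VF \<Longrightarrow> \<omega> X (- Y) = - \<omega> X Y"
  using omega_fscale_right[of X Y "-1"] by (simp add: fscale_simps)

lemma omega_diff_right: "X \<in> VF \<Longrightarrow> Y \<in> VF \<Longrightarrow> Z \<in> VF \<Longrightarrow> \<omega> X (Y - Z) = \<omega> X Y - \<omega> X Z"
  using omega_add_right[of X Y "- Z"] by (simp add: omega_minus_right)

lemma omega_0_right: "X \<in> VF \<Longrightarrow> \<omega> X 0 = 0"
  using omega_fscale_right[of X 0 0] by (simp add: fscale_simps)

lemma omega_add_left: "X \<in> VF \<Longrightarrow> Y \<in> VF \<Longrightarrow> Z \<in> VF \<Longrightarrow> \<omega> (X + Y) Z = \<omega> X Z + \<omega> Y Z"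
  and omega_diff_left: "X \<in> VF \<Longrightarrow> Y \<in> VF \<Longrightarrow> Z \<in> VF \<Longrightarrow> \<omega> (X - Y) Z = \<omega> X Z - \<omega> Y Z"
  and omega_minus_left: "X \<in> VF \<Longrightarrow> Z \<in> VF \<Longrightarrow> \<omega> (- X) Z = - \<omega> X Z"
  and omega_fscale_left: "X \<in> VF \<Longrightarrow> Z \<in> VF \<Longrightarrow> f \<in> SF \<Longrightarrow> \<omega> (fscale f X) Z = f * \<omega> X Z"
  and omega_0_left: "Z \<in> VF \<Longrightarrow> \<omega> 0 Z = 0"
  by (simp_all add: omega_antisym[of _ Z] omega_add_right omega_diff_right omega_minus_right omega_fscale_right omega_0_right)

lemmas omega_simps = omega_add_right omega_fscale_right omega_minus_right omega_diff_right omega_0_right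
  omega_add_left omega_fscale_left omega_minus_left omega_diff_left omega_0_left

lemma omega_J_left: "Y \<in> CS \<Longrightarrow> Z \<in> CS \<Longrightarrow> \<omega> (J \<cdot> Y) Z = - \<omega> Y (J \<cdot> Z)"
  using omega_J_J[of Y "J \<cdot> Z"] by (simp add: J_simps omega_simps minus_equation_iff)

lemma h_sym: "Y \<in> CS \<Longrightarrow> Z \<in> CS \<Longrightarrow> h Y Z = h Z Y"
  by (simp add: omega_antisym[of Y] omega_J_left)

lemma functional_omega: "X \<in> VF \<Longrightarrow> functional (\<omega> X)"
  by (simp add: functional_def omega_simps)

text \<open>
  Positivity is a condition at points where \<open>Y\<close> does not vanish; at the others the value is zero by
  tensoriality.
\<close>

lemma h_nonneg: "Y \<in> CS \<Longrightarrow> h Y Y p \<ge> 0"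
proof (cases "Y p = 0")
  case True
  assume Y: "Y \<in> CS"
  have "\<omega> (J \<cdot> Y) Y p = 0"
    by (rule functional_at_zero[OF functional_omega]) (use Y True in auto)
  then show ?thesis
    using Y by (simp add: omega_J_left)
qed (use h_pos in \<open>auto intro: less_imp_le\<close>)

text \<open>
  Identities between contact sections are tested by pairing, which turns them into identities between
  functions.
\<close>

lemma CS_eqI:
  assumes "X \<in> CS" "Y \<in> CS" "\<And>Z. Z \<in> CS \<Longrightarrow> h X Z = h Y Z"
  shows "X = Y"
proof -
  have "h (X - Y) (X - Y) = 0"
    using assms by (simp add: omega_simps)
  then have "(X - Y) p = 0" for p
    using h_pos[of "X - Y" p] assms(1,2) by (cases "(X - Y) p = 0") auto
  then show ?thesis
    by (auto simp: fun_eq_iff)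
qed

text \<open>
  If \<open>lam\<close> vanished at \<open>p\<close>, so would every term of the volume form \<open>lam \<and> (d lam)^n\<close> at \<open>p\<close>.
\<close>

lemma exists_transverse: "\<exists>Z\<in>VF. L Z p \<noteq> 0"
proof (rule ccontr)
  assume "\<not> ?thesis"
  then have 0: "lam p (Z p) = 0" if "Z \<in> VF" for Z
    using that by (auto simp: at_points_def)
  have contact: "\<forall>p. \<exists>Xs. length Xs = 2 * n + 1 \<and> set Xs \<subseteq> VF \<and> contact_volume n lam Xs p \<noteq> 0"
    using triad unfolding contact_triad_def contact_form_def by (elim conjE) assumption
  obtain Xs where Xs: "length Xs = 2 * n + 1" "set Xs \<subseteq> VF" "contact_volume n lam Xs p \<noteq> 0"
    using contact by blast
  have "lam p ((Xs ! \<sigma> 0) p) = 0" if "\<sigma> permutes {..<1 + 2 * n}" for \<sigma>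
  proof (rule 0)
    have "\<sigma> 0 < 2 * n + 1"
      using permutes_in_image[OF that, of 0] by simp
    then show "Xs ! \<sigma> 0 \<in> VF"
      using Xs by (metis nth_mem subsetD)
  qed
  then have "contact_volume n lam Xs p = 0"
    unfolding contact_volume_def wedge_def by (auto simp: at_points_def intro!: sum.neutral)
  with Xs(3) show False by simp
qed

text \<open>
  Let \<open>Z\<close> be transverse to the contact distribution near \<open>p\<close>. The compatibility of \<open>J\<close> makes \<open>d lam\<close>
  nondegenerate on contact sections, so some contact section has the same pairings as \<open>Z\<close> with all
  contact sections, and the difference spans the kernel of \<open>d lam\<close>. To have \<open>local_Riesz\<close> available for
  this, the form \<open>h\<close> on contact sections is extended to a form \<open>G\<close> on all fields, with the projection
  \<open>P\<close> along \<open>Z\<close>, scaled by \<open>L Z\<close> to avoid division.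
\<close>

lemma local_Reeb: "\<exists>M\<in>VF. L M p \<noteq> 0 \<and> (\<forall>T\<in>VF. \<omega> M T = 0)"
proof -
  obtain Z where Z: "Z \<in> VF" "L Z p \<noteq> 0"
    using exists_transverse by blast
  define P where "P X = fscale (L Z) X - fscale (L X) Z" for X
  have P_CS [simp]: "P X \<in> CS" if "X \<in> VF" for X
    using that Z(1) by (simp add: CS_iff P_def L_simps mult.commute)
  have P_add: "P (X + Y) = P X + P Y" if "X \<in> VF" "Y \<in> VF" for X Y
    using that by (simp add: P_def L_simps fscale_simps)
  have P_fscale: "P (fscale f X) = fscale f (P X)" if "X \<in> VF" "f \<in> SF" for X f
    using that by (simp add: P_def L_simps fscale_simps mult_ac)
  define G where "G X Y = L X * L Y + h (P X) (P Y)" for X Y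
  have G_functional: "functional (G X)" if "X \<in> VF" for X
    using that unfolding functional_def G_def
    by (simp add: L_simps P_add P_fscale J_simps omega_simps algebra_simps)
  have G_sym: "G X Y = G Y X" if "X \<in> VF" "Y \<in> VF" for X Y
    using that h_sym[of "P X" "P Y"] by (simp add: G_def mult.commute)
  have G_definite: "G X X p \<noteq> 0" if X: "X \<in> VF" "X p \<noteq> 0" for X
  proof (cases "P X p = 0")
    case True
    have "L X p \<noteq> 0"
    proof
      assume "L X p = 0"
      then have "L Z p * X p f = 0" for f
        using fun_cong[OF True, of f] by (simp add: P_def fscale_def tscale_def)
      then show False
        using X(2) Z(2) by (auto simp: fun_eq_iff)
    qed
    then have "L X p * L X p > 0"
      by (auto simp: zero_less_mult_iff neq_iff)
    then show ?thesis
      using h_nonneg[OF P_CS[OF X(1)], of p] by (simp add: G_def)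
  next
    case False
    then have "L X p * L X p + h (P X) (P X) p > 0"
      by (intro add_nonneg_pos zero_le_square h_pos P_CS X(1))
    then show ?thesis
      by (simp add: G_def)
  qed
  obtain u where u: "u \<in> SF" "u p \<noteq> 0"
    and solve: "\<And>F. functional F \<Longrightarrow> \<exists>W\<in>VF. \<forall>X\<in>VF. G W X = u * F X"
    by (rule local_Riesz[of G p, OF G_functional G_sym G_definite]) (assumption+, rule that)
  have "functional (\<lambda>X. \<omega> Z (J \<cdot> P X))"
    using Z(1) unfolding functional_def
    by (simp add: P_add P_fscale J_simps omega_simps)
  then obtain W where W: "W \<in> VF" "\<And>X. X \<in> VF \<Longrightarrow> G W X = u * \<omega> Z (J \<cdot> P X)"
    using solve by blast
  \<comment> \<open>\<open>N\<close> pairs to zero with contact sections and, by antisymmetry, with itself. Since \<open>L N * T\<close> differs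
    from a multiple of \<open>N\<close> by a contact section, \<open>L N * N\<close> pairs to zero with every \<open>T\<close>.\<close>
  define N where "N = fscale (L Z) (fscale u Z - P W)"
  have N: "N \<in> VF"
    using Z(1) u(1) W(1) by (simp add: N_def)
  have LN: "L N = L Z * (u * L Z)"
    using Z(1) u(1) W(1) by (simp add: N_def L_simps L_CS)
  have N0: "\<omega> N Y = 0" if Y: "Y \<in> CS" for Y
  proof -
    let ?X = "- (J \<cdot> Y)"
    have PX: "J \<cdot> P ?X = fscale (L Z) Y"
      using Y Z(1) by (simp add: P_def L_simps L_CS J_simps fscale_simps)
    have "G W ?X = L Z * \<omega> (P W) Y"
      using Y Z(1) W(1) by (simp add: G_def PX omega_simps L_simps L_CS)
    then have "L Z * \<omega> (P W) Y = u * (L Z * \<omega> Z Y)"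
      using W(2)[of ?X] Y Z(1) by (simp add: PX omega_simps)
    then show ?thesis
      using Y Z(1) W(1) u(1) by (simp add: N_def omega_simps algebra_simps)
  qed
  show ?thesis
  proof (intro bexI[of _ "fscale (L N) N"] conjI ballI)
    show "fscale (L N) N \<in> VF"
      using N by simp
    show "L (fscale (L N) N) p \<noteq> 0"
      using N LN Z(2) u(2) by (simp add: L_simps)
    fix T assume T: "T \<in> VF"
    have "fscale (L N) T - fscale (L T) N \<in> CS"
      using N T by (simp add: CS_iff L_simps mult.commute)
    from N0[OF this] show "\<omega> (fscale (L N) N) T = 0"
      using N T by (simp add: omega_simps omega_self)
  qed
qed

text \<open>
  Two fields in the kernel of \<open>d lam\<close> are proportional: the combination below is a contact section in
  the kernel. This gives both the compatibility needed for gluing and the uniqueness of the Reeb field.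
\<close>

lemma Reeb_unique:
  assumes "X \<in> VF" "Y \<in> VF" "\<And>T. T \<in> VF \<Longrightarrow> \<omega> X T = 0" "\<And>T. T \<in> VF \<Longrightarrow> \<omega> Y T = 0"
  shows "fscale (L Y) X = fscale (L X) Y"
proof -
  have "fscale (L Y) X - fscale (L X) Y = 0"
  proof (rule CS_eqI)
    show "fscale (L Y) X - fscale (L X) Y \<in> CS"
      using assms(1,2) by (simp add: CS_iff L_simps mult.commute)
  qed (use assms in \<open>simp_all add: omega_simps\<close>)
  then show ?thesis by simp
qed

lemma Reeb_ex1:
  "\<exists>!X. X \<in> VF \<and> L X = 1 \<and> (\<forall>Y\<in>VF. \<omega> X Y = 0)"
proof (rule ex_ex1I)
  obtain M where M: "\<And>p. M p \<in> VF" "\<And>p. L (M p) p \<noteq> 0" "\<And>p T. T \<in> VF \<Longrightarrow> \<omega> (M p) T = 0"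
    using local_Reeb by metis
  obtain X where X: "X \<in> VF" "\<And>p. fscale (L (M p)) X = M p"
  proof (rule VF_glue[where u = "\<lambda>p. L (M p)" and W = M])
    show "fscale (L (M q)) (M p) = fscale (L (M p)) (M q)" for p q
      by (rule Reeb_unique) (use M in auto)
  qed (use M that in auto)
  have "L X p = 1" for p
    using arg_cong[OF X(2)[of p], of "\<lambda>X. L X p"] X(1) M(2)[of p] by (simp add: L_simps)
  moreover have "\<omega> X T p = 0" if "T \<in> VF" for T p
    using arg_cong[OF X(2)[of p], of "\<lambda>X. \<omega> X T p"] X(1) M(1-2)[of p] M(3)[OF that, of p] that
    by (simp add: omega_simps)
  ultimately show "\<exists>X. X \<in> VF \<and> L X = 1 \<and> (\<forall>Y\<in>VF. \<omega> X Y = 0)"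
    using X(1) by (intro exI[of _ X]) (auto simp: fun_eq_iff)
next
  show "X = Y" if "X \<in> VF \<and> L X = 1 \<and> (\<forall>T\<in>VF. \<omega> X T = 0)" "Y \<in> VF \<and> L Y = 1 \<and> (\<forall>T\<in>VF. \<omega> Y T = 0)"
    for X Y
    using Reeb_unique[of X Y] that by (simp add: fscale_simps)
qed

abbreviation "R \<equiv> reeb A lam"

lemma R_VF [simp]: "R \<in> VF" and L_R: "L R = 1" and omega_R_left: "Y \<in> VF \<Longrightarrow> \<omega> R Y = 0"
  using theI'[OF Reeb_ex1] unfolding reeb_def by auto

abbreviation "pr X \<equiv> xi_proj A lam \<cdot> X"

lemma pr_eq: "pr X = X - fscale (L X) R"
  by (intro ext) (simp add: at_points_def xi_proj_def fscale_def)

lemma pr_CS [simp]: "X \<in> VF \<Longrightarrow> pr X \<in> CS"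
  by (simp add: CS_iff pr_eq L_simps L_R)

lemma pr_add: "X \<in> VF \<Longrightarrow> Y \<in> VF \<Longrightarrow> pr (X + Y) = pr X + pr Y"
  and pr_diff: "X \<in> VF \<Longrightarrow> Y \<in> VF \<Longrightarrow> pr (X - Y) = pr X - pr Y"
  and pr_minus: "X \<in> VF \<Longrightarrow> pr (- X) = - pr X"
  and pr_fscale: "X \<in> VF \<Longrightarrow> f \<in> SF \<Longrightarrow> pr (fscale f X) = fscale f (pr X)"
  and pr_of_CS: "Y \<in> CS \<Longrightarrow> pr Y = Y"
  and pr_R: "pr R = 0"
  by (simp_all add: pr_eq L_simps L_CS L_R fscale_simps)

lemma pr_0: "pr 0 = 0"
  by (simp add: pr_of_CS)

lemmas pr_simps = pr_add pr_diff pr_minus pr_fscale pr_R pr_0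

lemma decompose: "X = fscale (L X) R + pr X"
  by (simp add: pr_eq)

abbreviation "g \<equiv> triad_metric A lam J"

lemma g_eq: "g X Y = L X * L Y + h (pr X) (pr Y)"
  by (simp add: triad_metric_def)

lemma g_sym: "X \<in> VF \<Longrightarrow> Y \<in> VF \<Longrightarrow> g X Y = g Y X"
  using h_sym[of "pr X" "pr Y"] by (simp add: g_eq mult.commute)

lemma functional_g: "X \<in> VF \<Longrightarrow> functional (g X)"
  unfolding functional_def g_eq
  by (simp add: L_simps pr_simps J_simps omega_simps algebra_simps)

lemma g_diff_left: "X \<in> VF \<Longrightarrow> Y \<in> VF \<Longrightarrow> Z \<in> VF \<Longrightarrow> g (X - Y) Z = g X Z - g Y Z"
  and g_fscale_left: "X \<in> VF \<Longrightarrow> Z \<in> VF \<Longrightarrow> f \<in> SF \<Longrightarrow> g (fscale f X) Z = f * g X Z"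
  unfolding g_eq by (simp_all add: L_simps pr_simps omega_simps algebra_simps)

lemma g_pos:
  assumes X: "X \<in> VF" "X p \<noteq> 0"
  shows "g X X p > 0"
proof (cases "pr X p = 0")
  case True
  have "L X p \<noteq> 0"
  proof
    assume "L X p = 0"
    then have "X p f = 0" for f
      using fun_cong[OF True, of f] by (simp add: pr_eq fscale_def tscale_def)
    then show False
      using X(2) by (auto simp: fun_eq_iff)
  qed
  then have "L X p * L X p > 0"
    by (auto simp: zero_less_mult_iff neq_iff)
  then show ?thesis
    using h_nonneg[OF pr_CS[OF X(1)], of p] by (simp add: g_eq)
next
  case False
  then have "L X p * L X p + h (pr X) (pr X) p > 0"
    by (intro add_nonneg_pos zero_le_square h_pos pr_CS X(1))
  then show ?thesis
    by (simp add: g_eq)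
qed

lemma g_eqI:
  assumes "X \<in> VF" "Y \<in> VF" "\<And>Z. Z \<in> VF \<Longrightarrow> g X Z = g Y Z"
  shows "X = Y"
proof -
  have "g (X - Y) (X - Y) = 0"
    using assms by (simp add: g_diff_left)
  then have "(X - Y) p = 0" for p
    using g_pos[of "X - Y" p] assms(1,2) by (cases "(X - Y) p = 0") auto
  then show ?thesis
    by (auto simp: fun_eq_iff)
qed

text \<open>
  Local solutions are unique by positivity of \<open>g\<close>, which is the compatibility needed for gluing.
\<close>

lemma Riesz:
  assumes F: "functional F"
  shows "\<exists>W\<in>VF. \<forall>X\<in>VF. g W X = F X"
proof -
  have "\<exists>u W. u \<in> SF \<and> u p \<noteq> 0 \<and> W \<in> VF \<and> (\<forall>X\<in>VF. g W X = u * F X)" for p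
  proof (rule local_Riesz[of g p])
    show "g X X p \<noteq> 0" if "X \<in> VF" "X p \<noteq> 0" for X
      using g_pos[OF that] by simp
    show ?thesis if "u \<in> SF" "u p \<noteq> 0"
      "\<And>F. functional F \<Longrightarrow> \<exists>W\<in>VF. \<forall>X\<in>VF. g W X = u * F X" for u
      using that F by blast
  qed (use functional_g g_sym in auto)
  then obtain u W where u: "\<And>p. u p \<in> SF" "\<And>p. u p p \<noteq> 0"
    and W: "\<And>p. W p \<in> VF" "\<And>p X. X \<in> VF \<Longrightarrow> g (W p) X = u p * F X"
    by metis
  obtain V where V: "V \<in> VF" "\<And>p. fscale (u p) V = W p"
  proof (rule VF_glue[where u = u and W = W])
    show "fscale (u q) (W p) = fscale (u p) (W q)" for p q
      by (rule g_eqI) (use u W in \<open>simp_all add: g_fscale_left mult_ac\<close>)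
  qed (use u W that in auto)
  have "g V X p = F X p" if "X \<in> VF" for X p
    using fun_cong[OF W(2)[OF that, of p], of p] u[of p] V(1) that
    by (simp add: V(2)[of p, symmetric] g_fscale_left)
  then show ?thesis
    using V(1) by (intro bexI[of _ V]) (auto simp: fun_eq_iff)
qed

lemma CS_Riesz:
  assumes "\<And>Z. Z \<in> CS \<Longrightarrow> F Z \<in> SF" "\<And>Y Z. Y \<in> CS \<Longrightarrow> Z \<in> CS \<Longrightarrow> F (Y + Z) = F Y + F Z"
    and "\<And>f Z. f \<in> SF \<Longrightarrow> Z \<in> CS \<Longrightarrow> F (fscale f Z) = f * F Z"
  obtains W where "W \<in> CS" "\<And>Z. Z \<in> CS \<Longrightarrow> h W Z = F Z"
proof -
  have "functional (\<lambda>X. F (pr X))"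
    using assms by (simp add: functional_def pr_simps)
  then obtain W where W: "W \<in> VF" "\<And>X. X \<in> VF \<Longrightarrow> g W X = F (pr X)"
    using Riesz by blast
  show thesis
  proof
    show "pr W \<in> CS" using W(1) by simp
    show "h (pr W) Z = F Z" if "Z \<in> CS" for Z
      using W(2)[of Z] that by (simp add: g_eq L_CS pr_of_CS)
  qed
qed

lemma L_lie_R: "Y \<in> VF \<Longrightarrow> L (lie_bracket R Y) = deriv_along R (L Y)"
  using omega_R_left[of Y] by (simp add: ext_deriv_def L_R deriv_along_simps)

lemma CS_lie_R [simp]: "Y \<in> CS \<Longrightarrow> lie_bracket R Y \<in> CS"
  by (simp add: CS_iff L_lie_R deriv_along_simps)

lemma omega_CS: "Y \<in> CS \<Longrightarrow> Z \<in> CS \<Longrightarrow> \<omega> Y Z = - L (lie_bracket Y Z)"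
  by (simp add: ext_deriv_def L_CS deriv_along_simps)

text \<open>
  The Reeb flow preserves \<open>d lam\<close>. For contact sections \<open>\<omega> Y Z = - lam [Y, Z]\<close>, and \<open>lam [R, X] = R (lam X)\<close>
  for all \<open>X\<close>, so that the claim is \<open>lam\<close> applied to the Jacobi identity.
\<close>

lemma deriv_R_omega:
  assumes "Y \<in> CS" "Z \<in> CS"
  shows "deriv_along R (\<omega> Y Z) = \<omega> (lie_bracket R Y) Z + \<omega> Y (lie_bracket R Z)"
  using assms Jacobi[of R Y Z]
  by (simp add: omega_CS deriv_along_simps L_lie_R[symmetric] L_simps)

end

context triad
begin

section \<open>The connection along the Reeb field\<close>

definition half :: "'a \<Rightarrow> real" where "half = (\<lambda>_. 1 / 2)"

lemma half_SF [simp]: "half \<in> SF" and half_apply [simp]: "half p = 1 / 2"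
  by (simp_all add: half_def)

text \<open>
  The derivative \<open>\<nabla>_R Y\<close> of a contact section \<open>Y\<close> in the Reeb direction, and below it \<open>\<nabla>_Y R\<close>. The conditions on the
  connection leave no choice: vanishing of \<open>T(R, Y)\<close> says \<open>\<nabla>_Y R = \<nabla>_R Y - [R, Y]\<close>, \<open>\<nabla>_R\<close> commutes with \<open>J\<close>, and
  \<open>Y \<mapsto> \<nabla>_Y R\<close> anticommutes with \<open>J\<close>. Hence \<open>\<nabla>_R\<close> is the part of \<open>[R, \<cdot>]\<close> that commutes with \<open>J\<close>.
\<close>

definition nabla_R :: "'a vfield \<Rightarrow> 'a vfield" where
  "nabla_R Y = fscale half (lie_bracket R Y - J \<cdot> lie_bracket R (J \<cdot> Y))"

definition nabla_of_R :: "'a vfield \<Rightarrow> 'a vfield" where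
  "nabla_of_R Y = nabla_R Y - lie_bracket R Y"

lemma nabla_R_CS [simp]: "Y \<in> CS \<Longrightarrow> nabla_R Y \<in> CS" and nabla_of_R_CS [simp]: "Y \<in> CS \<Longrightarrow> nabla_of_R Y \<in> CS"
  by (simp_all add: nabla_R_def nabla_of_R_def)

lemma nabla_R_add: "X \<in> CS \<Longrightarrow> Y \<in> CS \<Longrightarrow> nabla_R (X + Y) = nabla_R X + nabla_R Y"
  by (simp add: nabla_R_def lie_bracket_simps J_simps fscale_simps)

lemma nabla_R_fscale:
  assumes "Y \<in> CS" "f \<in> SF"
  shows "nabla_R (fscale f Y) = fscale f (nabla_R Y) + fscale (deriv_along R f) Y"
proof -
  have "nabla_R (fscale f Y) = fscale half (fscale f (lie_bracket R Y) + fscale (deriv_along R f) Y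
      - (fscale f (J \<cdot> lie_bracket R (J \<cdot> Y)) - fscale (deriv_along R f) Y))"
    using assms by (simp add: nabla_R_def lie_bracket_simps J_simps fscale_simps)
  also have "\<dots> = fscale f (nabla_R Y) + fscale (deriv_along R f) Y"
    by (intro ext) (simp add: nabla_R_def fscale_def tscale_def algebra_simps)
  finally show ?thesis .
qed

lemma nabla_R_J: "Y \<in> CS \<Longrightarrow> nabla_R (J \<cdot> Y) = J \<cdot> nabla_R Y"
  by (simp add: nabla_R_def lie_bracket_simps J_simps fscale_simps algebra_simps)

text \<open>
  Average the invariance of \<open>d lam\<close> under the Reeb flow for the pairs \<open>Y, J Z\<close> and \<open>J Y, Z\<close>.
\<close>

lemma nabla_R_metric:
  assumes "Y \<in> CS" "Z \<in> CS"
  shows "deriv_along R (h Y Z) = h (nabla_R Y) Z + h Y (nabla_R Z)"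
proof (rule ext)
  fix p
  have 1: "deriv_along R (\<omega> Y (J \<cdot> Z)) =
      \<omega> (lie_bracket R Y) (J \<cdot> Z) + \<omega> Y (lie_bracket R (J \<cdot> Z))"
    using assms by (intro deriv_R_omega) auto
  have "deriv_along R (\<omega> (J \<cdot> Y) Z) =
      \<omega> (lie_bracket R (J \<cdot> Y)) Z + \<omega> (J \<cdot> Y) (lie_bracket R Z)"
    using assms by (intro deriv_R_omega) auto
  then have 2: "deriv_along R (\<omega> Y (J \<cdot> Z)) =
      - \<omega> (lie_bracket R (J \<cdot> Y)) Z + \<omega> Y (J \<cdot> lie_bracket R Z)"
    using assms by (simp add: omega_J_left deriv_along_simps algebra_simps)
  show "deriv_along R (h Y Z) p = (h (nabla_R Y) Z + h Y (nabla_R Z)) p"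
    using assms fun_cong[OF 1, of p] fun_cong[OF 2, of p]
    by (simp add: nabla_R_def omega_simps J_simps omega_J_J field_simps)
qed

lemma nabla_of_R_add: "X \<in> CS \<Longrightarrow> Y \<in> CS \<Longrightarrow> nabla_of_R (X + Y) = nabla_of_R X + nabla_of_R Y"
  by (simp add: nabla_of_R_def nabla_R_add lie_bracket_simps)

lemma nabla_of_R_fscale: "Y \<in> CS \<Longrightarrow> f \<in> SF \<Longrightarrow> nabla_of_R (fscale f Y) = fscale f (nabla_of_R Y)"
  by (simp add: nabla_of_R_def nabla_R_fscale lie_bracket_simps fscale_simps)

lemma nabla_of_R_J:
  assumes "Y \<in> CS"
  shows "nabla_of_R (J \<cdot> Y) = - (J \<cdot> nabla_of_R Y)"
proof -
  have 1: "nabla_of_R (J \<cdot> Y) = fscale half (lie_bracket R (J \<cdot> Y) + J \<cdot> lie_bracket R Y) - lie_bracket R (J \<cdot> Y)"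
    and 2: "- (J \<cdot> nabla_of_R Y) =
      - (fscale half (J \<cdot> lie_bracket R Y + lie_bracket R (J \<cdot> Y)) - J \<cdot> lie_bracket R Y)"
    using assms by (simp_all add: nabla_of_R_def nabla_R_def lie_bracket_simps J_simps)
  show ?thesis
    unfolding 1 2 by (intro ext) (simp add: fscale_def tscale_def field_simps)
qed

section \<open>The canonical connection of the contact distribution\<close>

definition xi_bracket :: "'a vfield \<Rightarrow> 'a vfield \<Rightarrow> 'a vfield" where
  "xi_bracket X Y = pr (lie_bracket X Y)"

lemma xi_bracket_CS [simp]: "X \<in> CS \<Longrightarrow> Y \<in> CS \<Longrightarrow> xi_bracket X Y \<in> CS"
  by (simp add: xi_bracket_def)

lemma xi_bracket_antisym: "X \<in> CS \<Longrightarrow> Y \<in> CS \<Longrightarrow> xi_bracket Y X = - xi_bracket X Y"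
  using lie_bracket_antisym[of X Y] by (simp add: xi_bracket_def pr_simps)

lemma xi_bracket_self: "xi_bracket X X = 0"
  by (simp add: xi_bracket_def lie_bracket_self pr_0)

lemma xi_bracket_add_left: "X \<in> CS \<Longrightarrow> Y \<in> CS \<Longrightarrow> Z \<in> CS \<Longrightarrow> xi_bracket (X + Y) Z = xi_bracket X Z + xi_bracket Y Z"
  and xi_bracket_add_right: "X \<in> CS \<Longrightarrow> Y \<in> CS \<Longrightarrow> Z \<in> CS \<Longrightarrow> xi_bracket X (Y + Z) = xi_bracket X Y + xi_bracket X Z"
  and xi_bracket_minus_left: "X \<in> CS \<Longrightarrow> Y \<in> CS \<Longrightarrow> xi_bracket (- X) Y = - xi_bracket X Y"
  and xi_bracket_minus_right: "X \<in> CS \<Longrightarrow> Y \<in> CS \<Longrightarrow> xi_bracket X (- Y) = - xi_bracket X Y"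
  and xi_bracket_fscale_left: "X \<in> CS \<Longrightarrow> Y \<in> CS \<Longrightarrow> f \<in> SF \<Longrightarrow>
    xi_bracket (fscale f X) Y = fscale f (xi_bracket X Y) - fscale (deriv_along Y f) X"
  and xi_bracket_fscale_right: "X \<in> CS \<Longrightarrow> Y \<in> CS \<Longrightarrow> f \<in> SF \<Longrightarrow>
    xi_bracket X (fscale f Y) = fscale f (xi_bracket X Y) + fscale (deriv_along X f) Y"
  by (simp_all add: xi_bracket_def lie_bracket_simps pr_simps pr_of_CS)

lemmas xi_bracket_simps = xi_bracket_add_left xi_bracket_add_right xi_bracket_minus_left xi_bracket_minus_right xi_bracket_fscale_left xi_bracket_fscale_right

text \<open>
  The combination \<open>\<nabla>_X Y + J \<nabla>_(J X) Y\<close>, which is twice the \<open>(0,1)\<close>-part of the connection. For a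
  connection that commutes with \<open>J\<close> it is determined by the torsion condition: polarizing \<open>T(J Y, Y) = 0\<close> expresses its symmetrization, and
  the polarized identity for \<open>Y, J Z\<close> its antisymmetrization, through Lie brackets.
\<close>

definition dbar :: "'a vfield \<Rightarrow> 'a vfield \<Rightarrow> 'a vfield" where
  "dbar X Y = fscale half
    (xi_bracket X Y + xi_bracket (J \<cdot> X) (J \<cdot> Y) - J \<cdot> xi_bracket X (J \<cdot> Y) + J \<cdot> xi_bracket (J \<cdot> X) Y)"

lemma dbar_CS [simp]: "X \<in> CS \<Longrightarrow> Y \<in> CS \<Longrightarrow> dbar X Y \<in> CS"
  by (simp add: dbar_def)

lemma dbar_add_left: "X \<in> CS \<Longrightarrow> Y \<in> CS \<Longrightarrow> Z \<in> CS \<Longrightarrow> dbar (X + Y) Z = dbar X Z + dbar Y Z"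
  and dbar_add_right: "X \<in> CS \<Longrightarrow> Y \<in> CS \<Longrightarrow> Z \<in> CS \<Longrightarrow> dbar X (Y + Z) = dbar X Y + dbar X Z"
  by (simp_all add: dbar_def xi_bracket_simps J_simps fscale_simps)

lemma dbar_fscale_left:
  assumes "X \<in> CS" "Y \<in> CS" "f \<in> SF"
  shows "dbar (fscale f X) Y = fscale f (dbar X Y)"
  using assms by (simp add: dbar_def xi_bracket_simps J_simps fscale_simps mult.commute)

lemma dbar_fscale_right:
  assumes "X \<in> CS" "Y \<in> CS" "f \<in> SF"
  shows "dbar X (fscale f Y) =
    fscale f (dbar X Y) + fscale (deriv_along X f) Y + fscale (deriv_along (J \<cdot> X) f) (J \<cdot> Y)"
proof -
  have "dbar X (fscale f Y) = fscale half
    (fscale f (xi_bracket X Y) + fscale (deriv_along X f) Y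
     + (fscale f (xi_bracket (J \<cdot> X) (J \<cdot> Y)) + fscale (deriv_along (J \<cdot> X) f) (J \<cdot> Y))
     - (fscale f (J \<cdot> xi_bracket X (J \<cdot> Y)) - fscale (deriv_along X f) Y)
     + (fscale f (J \<cdot> xi_bracket (J \<cdot> X) Y) + fscale (deriv_along (J \<cdot> X) f) (J \<cdot> Y)))"
    using assms by (simp add: dbar_def xi_bracket_simps J_simps fscale_simps)
  also have "\<dots> =
      fscale f (dbar X Y) + fscale (deriv_along X f) Y + fscale (deriv_along (J \<cdot> X) f) (J \<cdot> Y)"
    by (intro ext) (simp add: dbar_def fscale_def tscale_def algebra_simps)
  finally show ?thesis .
qed

lemma dbar_J_right: "X \<in> CS \<Longrightarrow> Y \<in> CS \<Longrightarrow> dbar X (J \<cdot> Y) = J \<cdot> dbar X Y"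
  and dbar_J_left: "X \<in> CS \<Longrightarrow> Y \<in> CS \<Longrightarrow> dbar (J \<cdot> X) Y = - (J \<cdot> dbar X Y)"
  by (simp_all add: dbar_def xi_bracket_simps J_simps fscale_simps algebra_simps)

text \<open>
  As for the Chern connection of a Hermitian holomorphic bundle, compatibility with the metric then
  determines the \<open>(1,0)\<close>-part: differentiating \<open>h Y Z\<close> along \<open>X\<close> and \<open>h Y (J Z)\<close> along \<open>J X\<close> and adding gives
  \<open>h (\<nabla>_X Y - J \<nabla>_(J X) Y) Z + h Y (dbar X Z)\<close>. The function below is therefore \<open>h (\<nabla>_X Y) Z\<close>.
\<close>

definition xi_koszul :: "'a vfield \<Rightarrow> 'a vfield \<Rightarrow> 'a vfield \<Rightarrow> 'a \<Rightarrow> real" where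
  "xi_koszul X Y Z = half * (deriv_along X (h Y Z) + deriv_along (J \<cdot> X) (h Y (J \<cdot> Z))
    + h (dbar X Y) Z - h Y (dbar X Z))"

lemma xi_koszul_SF [simp]: "X \<in> CS \<Longrightarrow> Y \<in> CS \<Longrightarrow> Z \<in> CS \<Longrightarrow> xi_koszul X Y Z \<in> SF"
  by (simp add: xi_koszul_def)

lemma xi_koszul_add: "X \<in> CS \<Longrightarrow> Y \<in> CS \<Longrightarrow> Z \<in> CS \<Longrightarrow> Z' \<in> CS \<Longrightarrow>
    xi_koszul X Y (Z + Z') = xi_koszul X Y Z + xi_koszul X Y Z'"
  by (simp add: xi_koszul_def J_simps omega_simps deriv_along_simps dbar_add_right algebra_simps)

lemma xi_koszul_fscale: "X \<in> CS \<Longrightarrow> Y \<in> CS \<Longrightarrow> Z \<in> CS \<Longrightarrow> f \<in> SF \<Longrightarrow>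
    xi_koszul X Y (fscale f Z) = f * xi_koszul X Y Z"
  by (simp add: xi_koszul_def J_simps omega_simps deriv_along_simps dbar_fscale_right algebra_simps)

definition xi_conn :: "'a vfield \<Rightarrow> 'a vfield \<Rightarrow> 'a vfield" where
  "xi_conn X Y = (SOME W. W \<in> CS \<and> (\<forall>Z\<in>CS. h W Z = xi_koszul X Y Z))"

lemma
  assumes "X \<in> CS" "Y \<in> CS"
  shows xi_conn_CS [simp]: "xi_conn X Y \<in> CS" and h_xi_conn: "Z \<in> CS \<Longrightarrow> h (xi_conn X Y) Z = xi_koszul X Y Z"
proof -
  have "\<exists>W. W \<in> CS \<and> (\<forall>Z\<in>CS. h W Z = xi_koszul X Y Z)"
    by (rule CS_Riesz[of "xi_koszul X Y"]) (use assms xi_koszul_SF xi_koszul_add xi_koszul_fscale in auto)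
  then have "xi_conn X Y \<in> CS \<and> (\<forall>Z\<in>CS. h (xi_conn X Y) Z = xi_koszul X Y Z)"
    unfolding xi_conn_def by (rule someI_ex)
  then show "xi_conn X Y \<in> CS" "Z \<in> CS \<Longrightarrow> h (xi_conn X Y) Z = xi_koszul X Y Z"
    by auto
qed

lemma xi_conn_add_left: "X \<in> CS \<Longrightarrow> X' \<in> CS \<Longrightarrow> Y \<in> CS \<Longrightarrow> xi_conn (X + X') Y = xi_conn X Y + xi_conn X' Y"
  by (rule CS_eqI) (simp_all add: h_xi_conn omega_add_left,
    simp add: xi_koszul_def J_simps omega_simps deriv_along_simps dbar_add_left algebra_simps)

lemma xi_conn_add_right: "X \<in> CS \<Longrightarrow> Y \<in> CS \<Longrightarrow> Y' \<in> CS \<Longrightarrow> xi_conn X (Y + Y') = xi_conn X Y + xi_conn X Y'"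
  by (rule CS_eqI) (simp_all add: h_xi_conn omega_add_left,
    simp add: xi_koszul_def J_simps omega_simps deriv_along_simps dbar_add_right algebra_simps)

lemma xi_conn_fscale_left: "X \<in> CS \<Longrightarrow> Y \<in> CS \<Longrightarrow> f \<in> SF \<Longrightarrow> xi_conn (fscale f X) Y = fscale f (xi_conn X Y)"
  by (rule CS_eqI) (simp_all add: h_xi_conn omega_fscale_left,
    simp add: xi_koszul_def J_simps omega_simps deriv_along_simps dbar_fscale_left algebra_simps)

lemma xi_conn_fscale_right:
  assumes "X \<in> CS" "Y \<in> CS" "f \<in> SF"
  shows "xi_conn X (fscale f Y) = fscale f (xi_conn X Y) + fscale (deriv_along X f) Y"
proof (rule CS_eqI)
  fix Z assume Z: "Z \<in> CS"
  have "xi_koszul X (fscale f Y) Z = f * xi_koszul X Y Z + deriv_along X f * h Y Z"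
    using assms Z
    by (intro ext) (simp add: xi_koszul_def J_simps omega_simps omega_J_left deriv_along_simps dbar_fscale_right field_simps)
  then show "h (xi_conn X (fscale f Y)) Z = h (fscale f (xi_conn X Y) + fscale (deriv_along X f) Y) Z"
    using assms Z by (simp add: omega_simps h_xi_conn)
qed (use assms in simp_all)

lemma xi_conn_metric:
  assumes "X \<in> CS" "Y \<in> CS" "Z \<in> CS"
  shows "deriv_along X (h Y Z) = h (xi_conn X Y) Z + h Y (xi_conn X Z)"
proof (rule ext)
  fix p
  have "h Y (xi_conn X Z) = xi_koszul X Z Y"
    using assms h_sym[of Y "xi_conn X Z"] h_xi_conn by simp
  moreover have "h Z Y = h Y Z" "h (dbar X Z) Y = h Y (dbar X Z)" "h Z (dbar X Y) = h (dbar X Y) Z"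
    "h Z (J \<cdot> Y) = - h Y (J \<cdot> Z)"
    using assms h_sym omega_antisym[of Z Y] by (auto simp: J_simps omega_simps)
  ultimately show "deriv_along X (h Y Z) p = (h (xi_conn X Y) Z + h Y (xi_conn X Z)) p"
    using assms by (simp add: h_xi_conn xi_koszul_def deriv_along_simps field_simps del: J_J omega_simps)
qed

lemma xi_conn_J:
  assumes "X \<in> CS" "Y \<in> CS"
  shows "xi_conn X (J \<cdot> Y) = J \<cdot> xi_conn X Y"
proof (rule CS_eqI)
  fix Z assume Z: "Z \<in> CS"
  have "h (J \<cdot> xi_conn X Y) Z = - xi_koszul X Y (J \<cdot> Z)"
    using assms Z h_xi_conn[OF assms, of "J \<cdot> Z"] by (simp add: omega_J_left)
  moreover have "xi_koszul X (J \<cdot> Y) Z = - xi_koszul X Y (J \<cdot> Z)"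
    using assms Z
    by (simp add: xi_koszul_def dbar_J_right J_simps omega_simps omega_J_left deriv_along_simps algebra_simps)
  ultimately show "h (xi_conn X (J \<cdot> Y)) Z = h (J \<cdot> xi_conn X Y) Z"
    using assms Z by (simp add: h_xi_conn)
qed (use assms in simp_all)

lemma xi_conn_dbar:
  assumes "X \<in> CS" "Y \<in> CS"
  shows "xi_conn X Y + J \<cdot> xi_conn (J \<cdot> X) Y = dbar X Y"
proof (rule CS_eqI)
  fix Z assume Z: "Z \<in> CS"
  have "h (J \<cdot> xi_conn (J \<cdot> X) Y) Z = - xi_koszul (J \<cdot> X) Y (J \<cdot> Z)"
    using assms Z h_xi_conn[of "J \<cdot> X" Y "J \<cdot> Z"] by (simp add: omega_J_left)
  moreover have "xi_koszul X Y Z - xi_koszul (J \<cdot> X) Y (J \<cdot> Z) = h (dbar X Y) Z"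
    using assms Z
    by (intro ext) (simp add: xi_koszul_def dbar_J_right dbar_J_left J_simps omega_simps omega_J_left deriv_along_simps
        field_simps)
  ultimately show "h (xi_conn X Y + J \<cdot> xi_conn (J \<cdot> X) Y) Z = h (dbar X Y) Z"
    using assms Z by (simp add: h_xi_conn omega_add_left)
qed (use assms in simp_all)

lemma xi_conn_torsion:
  assumes Y: "Y \<in> CS"
  shows "xi_conn (J \<cdot> Y) Y - xi_conn Y (J \<cdot> Y) = xi_bracket (J \<cdot> Y) Y"
proof -
  have "xi_conn (J \<cdot> Y) Y - xi_conn Y (J \<cdot> Y) = - (J \<cdot> dbar Y Y)"
    unfolding xi_conn_dbar[OF Y Y, symmetric] using Y by (simp add: xi_conn_J J_simps)
  moreover have "dbar Y Y = fscale half (J \<cdot> xi_bracket (J \<cdot> Y) Y + J \<cdot> xi_bracket (J \<cdot> Y) Y)"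
    using Y xi_bracket_antisym[of "J \<cdot> Y" Y] by (simp add: dbar_def xi_bracket_self J_simps)
  moreover have "\<dots> = J \<cdot> xi_bracket (J \<cdot> Y) Y"
    by (intro ext) (simp add: fscale_def tscale_def)
  ultimately show ?thesis
    using Y by (simp add: J_simps)
qed

text \<open>
  The computations that motivated \<open>dbar\<close> and \<open>xi_koszul\<close>, carried out for an arbitrary connection with the
  required properties.
\<close>

lemma xi_conn_unique:
  assumes F_CS [simp]: "\<And>X Y. X \<in> CS \<Longrightarrow> Y \<in> CS \<Longrightarrow> F X Y \<in> CS"
    and F_add_left: "\<And>X Y Z. X \<in> CS \<Longrightarrow> Y \<in> CS \<Longrightarrow> Z \<in> CS \<Longrightarrow> F (X + Y) Z = F X Z + F Y Z"
    and F_add_right: "\<And>X Y Z. X \<in> CS \<Longrightarrow> Y \<in> CS \<Longrightarrow> Z \<in> CS \<Longrightarrow> F X (Y + Z) = F X Y + F X Z"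
    and F_minus: "\<And>X Y. X \<in> CS \<Longrightarrow> Y \<in> CS \<Longrightarrow> F (- X) Y = - F X Y"
    and F_J: "\<And>X Y. X \<in> CS \<Longrightarrow> Y \<in> CS \<Longrightarrow> F X (J \<cdot> Y) = J \<cdot> F X Y"
    and F_metric: "\<And>X Y Z. X \<in> CS \<Longrightarrow> Y \<in> CS \<Longrightarrow> Z \<in> CS \<Longrightarrow>
      deriv_along X (h Y Z) = h (F X Y) Z + h Y (F X Z)"
    and F_torsion: "\<And>Y. Y \<in> CS \<Longrightarrow> F (J \<cdot> Y) Y - F Y (J \<cdot> Y) = xi_bracket (J \<cdot> Y) Y"
    and XY: "X \<in> CS" "Y \<in> CS"
  shows "F X Y = xi_conn X Y"
proof -
  define S where "S X Y = F X Y + J \<cdot> F (J \<cdot> X) Y" for X Y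
  \<comment> \<open>the torsion condition at \<open>X + Y\<close>, multiplied by \<open>J\<close>\<close>
  have polar: "S X Y + S Y X = J \<cdot> xi_bracket (J \<cdot> X) Y + J \<cdot> xi_bracket (J \<cdot> Y) X"
    if "X \<in> CS" "Y \<in> CS" for X Y
  proof -
    have "F (J \<cdot> X) Y + F (J \<cdot> Y) X - J \<cdot> F X Y - J \<cdot> F Y X = xi_bracket (J \<cdot> X) Y + xi_bracket (J \<cdot> Y) X"
      using F_torsion[of "X + Y"] F_torsion[of X] F_torsion[of Y] that
      by (simp add: F_add_left F_add_right F_J J_simps xi_bracket_simps algebra_simps)
    from arg_cong[OF this, of "\<lambda>X. J \<cdot> X"] show ?thesis
      using that by (simp add: S_def J_simps algebra_simps)
  qed
  have S_Q: "S X Y = dbar X Y" if X: "X \<in> CS" and Y: "Y \<in> CS" for X Y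
  proof -
    have S [simp]: "S X Y \<in> CS" if "X \<in> CS" "Y \<in> CS" for X Y
      using that by (simp add: S_def)
    have "S X (J \<cdot> Y) = J \<cdot> S X Y" "S (J \<cdot> Y) X = - (J \<cdot> S Y X)"
      using X Y by (simp_all add: S_def F_J F_minus J_simps)
    then have "J \<cdot> S X Y - J \<cdot> S Y X = J \<cdot> xi_bracket (J \<cdot> X) (J \<cdot> Y) - J \<cdot> xi_bracket Y X"
      using polar[of X "J \<cdot> Y"] X Y by (simp add: J_simps xi_bracket_simps)
    from arg_cong[OF this, of "\<lambda>X. - (J \<cdot> X)"]
    have 2: "S X Y - S Y X = xi_bracket (J \<cdot> X) (J \<cdot> Y) + xi_bracket X Y"
      using X Y xi_bracket_antisym[of X Y] by (simp add: J_simps)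
    have "S X Y = fscale half ((S X Y + S Y X) + (S X Y - S Y X))"
      by (intro ext) (simp add: fscale_def tscale_def)
    also have "\<dots> = dbar X Y"
      unfolding polar[OF X Y] 2 using X Y xi_bracket_antisym[of X "J \<cdot> Y"]
      by (simp add: dbar_def J_simps fscale_simps algebra_simps)
    finally show ?thesis .
  qed
  show ?thesis
  proof (rule CS_eqI)
    fix Z assume Z: "Z \<in> CS"
    note XYZ = XY Z
    have 1: "deriv_along X (h Y Z) = h (F X Y) Z + h Y (F X Z)"
      by (rule F_metric[OF XYZ])
    have 2: "deriv_along (J \<cdot> X) (h Y (J \<cdot> Z)) = h (F (J \<cdot> X) Y) (J \<cdot> Z) + h Y (J \<cdot> F (J \<cdot> X) Z)"
      using F_metric[of "J \<cdot> X" Y "J \<cdot> Z"] XYZ by (simp add: F_J)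
    have 3: "h (dbar X Y) Z = h (F X Y) Z - h (F (J \<cdot> X) Y) (J \<cdot> Z)"
      unfolding S_Q[OF XY, symmetric] S_def using XYZ by (simp add: omega_simps omega_J_left)
    have 4: "h Y (dbar X Z) = h Y (F X Z) + h Y (J \<cdot> F (J \<cdot> X) Z)"
      unfolding S_Q[OF XY(1) Z, symmetric] S_def using XYZ by (simp add: omega_simps J_add)
    have "xi_koszul X Y Z = h (F X Y) Z"
      unfolding xi_koszul_def 1 2 3 4 by (intro ext) simp
    then show "h (F X Y) Z = h (xi_conn X Y) Z"
      using XYZ by (simp add: h_xi_conn)
  qed (use XY in simp_all)
qed

section \<open>The contact triad connection\<close>

text \<open>
  The decomposition \<open>X = lam X * R + pr X\<close> reduces the connection to its values on the Reeb field and on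
  contact sections. For contact sections \<open>X, Y\<close> the component of \<open>\<nabla>_X Y\<close> along \<open>R\<close> is \<open>g (\<nabla>_X Y) R = - g Y (\<nabla>_X R)\<close>,
  because \<open>g\<close> is parallel and \<open>g Y R = 0\<close>.
\<close>

definition triad_conn :: "'a conn" where
  "triad_conn X Y = (if X \<in> VF \<and> Y \<in> VF then
      fscale (deriv_along X (L Y)) R + fscale (L X) (nabla_R (pr Y)) + fscale (L Y) (nabla_of_R (pr X))
      + xi_conn (pr X) (pr Y) - fscale (h (pr Y) (nabla_of_R (pr X))) R
    else 0)"

lemma triad_conn_eq: "X \<in> VF \<Longrightarrow> Y \<in> VF \<Longrightarrow> triad_conn X Y =
      fscale (deriv_along X (L Y)) R + fscale (L X) (nabla_R (pr Y)) + fscale (L Y) (nabla_of_R (pr X))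
      + xi_conn (pr X) (pr Y) - fscale (h (pr Y) (nabla_of_R (pr X))) R"
  by (simp add: triad_conn_def)

lemma triad_conn_VF [simp]: "X \<in> VF \<Longrightarrow> Y \<in> VF \<Longrightarrow> triad_conn X Y \<in> VF"
  by (simp add: triad_conn_eq)

lemma L_triad_conn: "X \<in> VF \<Longrightarrow> Y \<in> VF \<Longrightarrow> L (triad_conn X Y) = deriv_along X (L Y) - h (pr Y) (nabla_of_R (pr X))"
  by (simp add: triad_conn_eq L_simps L_R L_CS)

lemma pr_triad_conn: "X \<in> VF \<Longrightarrow> Y \<in> VF \<Longrightarrow>
    pr (triad_conn X Y) = fscale (L X) (nabla_R (pr Y)) + fscale (L Y) (nabla_of_R (pr X)) + xi_conn (pr X) (pr Y)"
  by (simp add: triad_conn_eq pr_simps pr_of_CS fscale_simps)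

lemma xi_conn_0_left: "Y \<in> CS \<Longrightarrow> xi_conn 0 Y = 0" and xi_conn_0_right: "X \<in> CS \<Longrightarrow> xi_conn X 0 = 0"
  using xi_conn_fscale_left[of 0 Y 0] xi_conn_fscale_right[of X 0 0]
  by (simp_all add: fscale_simps deriv_along_simps)

lemma nabla_of_R_0: "nabla_of_R 0 = 0" and nabla_R_0: "nabla_R 0 = 0"
  using nabla_of_R_fscale[of 0 0] nabla_R_fscale[of 0 0] by (simp_all add: fscale_simps deriv_along_simps)

lemma affine_triad_conn: "affine_connection A triad_conn"
  unfolding affine_connection_def
proof (intro conjI ballI allI impI)
  fix X Y assume XY: "X \<in> VF" "Y \<in> VF"
  show "triad_conn X Y \<in> VF" using XY by simp
  show "triad_conn (X + Z) Y = triad_conn X Y + triad_conn Z Y" if "Z \<in> VF" for Z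
    using XY that
    by (simp add: triad_conn_eq L_simps pr_simps deriv_along_simps nabla_of_R_add xi_conn_add_left J_simps omega_simps
        fscale_simps algebra_simps)
  show "triad_conn X (Y + Z) = triad_conn X Y + triad_conn X Z" if "Z \<in> VF" for Z
    using XY that
    by (simp add: triad_conn_eq L_simps pr_simps deriv_along_simps nabla_R_add xi_conn_add_right J_simps omega_simps
        fscale_simps algebra_simps)
  fix f assume f: "f \<in> SF"
  show "triad_conn (fscale f X) Y = fscale f (triad_conn X Y)"
    using XY f
    by (simp add: triad_conn_eq L_simps pr_simps deriv_along_simps nabla_of_R_fscale xi_conn_fscale_left J_simps omega_simps
        fscale_simps algebra_simps)
  have "fscale (deriv_along X f) Y = fscale (deriv_along X f * L Y) R + fscale (deriv_along X f) (pr Y)"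
    by (subst decompose[of Y]) (simp add: fscale_simps)
  moreover have "fscale (deriv_along X f) (pr Y) =
      fscale (deriv_along (pr X) f) (pr Y) + fscale (L X * deriv_along R f) (pr Y)"
    by (simp add: pr_eq[of X] deriv_along_simps fscale_simps)
  ultimately show "triad_conn X (fscale f Y) = fscale (deriv_along X f) Y + fscale f (triad_conn X Y)"
    using XY f
    by (simp add: triad_conn_eq L_simps pr_simps deriv_along_simps nabla_R_fscale xi_conn_fscale_right J_simps omega_simps
        fscale_simps algebra_simps)
next
  show "triad_conn X Y = 0" if "X \<notin> VF \<or> Y \<notin> VF" for X Y
    using that by (auto simp: triad_conn_def)
qed

text \<open>
  The terms with \<open>\<nabla>_X R\<close> cancel because they enter the connection in a skew-symmetric way.
\<close>

lemma riemannian_triad_conn: "riemannian_connection A g triad_conn"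
  unfolding riemannian_connection_def
proof (intro ballI ext)
  fix X Y Z p assume XYZ: "X \<in> VF" "Y \<in> VF" "Z \<in> VF"
  let ?Y = "pr Y" and ?Z = "pr Z"
  have "deriv_along X (h ?Y ?Z) = L X * deriv_along R (h ?Y ?Z) + deriv_along (pr X) (h ?Y ?Z)"
    using XYZ by (simp add: pr_eq[of X] deriv_along_simps)
  also have "\<dots> = L X * (h (nabla_R ?Y) ?Z + h ?Y (nabla_R ?Z)) + (h (xi_conn (pr X) ?Y) ?Z + h ?Y (xi_conn (pr X) ?Z))"
    using XYZ by (simp add: nabla_R_metric xi_conn_metric)
  finally have 1: "deriv_along X (h ?Y ?Z) =
      L X * (h (nabla_R ?Y) ?Z + h ?Y (nabla_R ?Z)) + (h (xi_conn (pr X) ?Y) ?Z + h ?Y (xi_conn (pr X) ?Z))" .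
  have "g (triad_conn X Y) Z = (deriv_along X (L Y) - h ?Y (nabla_of_R (pr X))) * L Z
      + (L X * h (nabla_R ?Y) ?Z + L Y * h (nabla_of_R (pr X)) ?Z + h (xi_conn (pr X) ?Y) ?Z)"
    using XYZ by (simp add: g_eq L_triad_conn pr_triad_conn omega_simps)
  moreover have "g Y (triad_conn X Z) = L Y * (deriv_along X (L Z) - h ?Z (nabla_of_R (pr X)))
      + (L X * h ?Y (nabla_R ?Z) + L Z * h ?Y (nabla_of_R (pr X)) + h ?Y (xi_conn (pr X) ?Z))"
    using XYZ by (simp add: g_eq L_triad_conn pr_triad_conn omega_simps J_simps)
  moreover have "h ?Z (nabla_of_R (pr X)) = h (nabla_of_R (pr X)) ?Z"
    using XYZ h_sym by simp
  moreover have "deriv_along X (g Y Z) = L Y * deriv_along X (L Z) + L Z * deriv_along X (L Y)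
      + deriv_along X (h ?Y ?Z)"
    using XYZ by (simp add: g_eq deriv_along_simps)
  ultimately show "deriv_along X (g Y Z) p = (g (triad_conn X Y) Z + g Y (triad_conn X Z)) p"
    by (simp only: 1) (simp add: algebra_simps)
qed

lemma triad_conn_Reeb: "X \<in> VF \<Longrightarrow> triad_conn X R = nabla_of_R (pr X)"
  by (simp add: triad_conn_eq L_R pr_R deriv_along_simps fscale_simps xi_conn_0_right nabla_R_0 omega_0_left)

lemma torsion_Reeb_triad_conn:
  assumes "Y \<in> VF"
  shows "torsion triad_conn R Y = 0"
proof -
  have "lie_bracket R Y = fscale (deriv_along R (L Y)) R + lie_bracket R (pr Y)"
    using assms by (subst decompose[of Y]) (simp add: lie_bracket_simps lie_bracket_self fscale_0_right)
  moreover have "triad_conn R Y = fscale (deriv_along R (L Y)) R + nabla_R (pr Y)"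
    using assms by (simp add: triad_conn_eq L_R pr_R nabla_of_R_0 xi_conn_0_left J_0 omega_0_right fscale_1 fscale_0_left fscale_0_right)
  ultimately show ?thesis
    using assms by (simp add: torsion_def triad_conn_Reeb nabla_of_R_def)
qed

lemma hermitian_triad_conn: "hermitian_connection A lam J (pi_connection A lam triad_conn)"
  unfolding hermitian_connection_def pi_connection_def
proof (intro ballI conjI)
  fix X Y assume X: "X \<in> VF" and Y: "Y \<in> CS"
  show "pr (triad_conn X (J \<cdot> Y)) = J \<cdot> pr (triad_conn X Y)"
    using X Y by (simp add: pr_triad_conn pr_of_CS L_CS nabla_R_J xi_conn_J J_simps fscale_simps)
  fix Z assume Z: "Z \<in> CS"
  have "deriv_along X (g Y Z) = g (triad_conn X Y) Z + g Y (triad_conn X Z)"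
    using riemannian_triad_conn X Y Z by (simp add: riemannian_connection_def)
  then show "deriv_along X (g Y Z) = g (pr (triad_conn X Y)) Z + g Y (pr (triad_conn X Z))"
    using X Y Z by (simp add: g_eq L_CS pr_of_CS)
qed

lemma torsion_J_triad_conn:
  assumes "Y \<in> CS"
  shows "pr (torsion triad_conn (J \<cdot> Y) Y) = 0"
  using assms xi_conn_torsion[OF assms]
  by (simp add: torsion_def pr_simps pr_triad_conn pr_of_CS L_CS fscale_simps xi_bracket_def)

lemma J_ext_Reeb_triad_conn:
  assumes "Y \<in> CS"
  shows "triad_conn (J \<cdot> Y) R + J_ext A lam J \<cdot> triad_conn Y R = 0"
proof -
  have "J_ext A lam J \<cdot> X = J \<cdot> pr X" for X
    by (simp add: at_points_def J_ext_def)
  then show ?thesis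
    using assms by (simp add: triad_conn_Reeb pr_of_CS nabla_of_R_J)
qed

text \<open>
  Each of the four blocks of a connection with these properties, with respect to the splitting into the
  Reeb direction and the contact distribution, is forced to be the corresponding block of \<open>triad_conn\<close>.
\<close>

lemma connection_unique:
  assumes aff: "affine_connection A F"
    and riem: "riemannian_connection A g F"
    and tors: "\<And>Y. Y \<in> VF \<Longrightarrow> torsion F R Y = 0"
    and RR: "F R R = 0" and CR: "\<And>Y. Y \<in> CS \<Longrightarrow> F Y R \<in> CS"
    and herm: "hermitian_connection A lam J (pi_connection A lam F)"
    and torsJ: "\<And>Y. Y \<in> CS \<Longrightarrow> pr (torsion F (J \<cdot> Y) Y) = 0"
    and antiJ: "\<And>Y. Y \<in> CS \<Longrightarrow> F (J \<cdot> Y) R + J_ext A lam J \<cdot> F Y R = 0"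
  shows "F = triad_conn"
proof -
  have F_VF [simp]: "F X Y \<in> VF"
    and F_add_left: "Z \<in> VF \<Longrightarrow> F (X + Z) Y = F X Y + F Z Y"
    and F_add_right: "Z \<in> VF \<Longrightarrow> F X (Y + Z) = F X Y + F X Z"
    and F_fscale_left: "f \<in> SF \<Longrightarrow> F (fscale f X) Y = fscale f (F X Y)"
    and F_fscale_right: "f \<in> SF \<Longrightarrow> F X (fscale f Y) = fscale (deriv_along X f) Y + fscale f (F X Y)"
    if "X \<in> VF" "Y \<in> VF" for X Y Z f
    using aff that unfolding affine_connection_def by simp_all
  have F_metric: "deriv_along X (g Y Z) = g (F X Y) Z + g Y (F X Z)"
    if "X \<in> VF" "Y \<in> VF" "Z \<in> VF" for X Y Z
    using riem that unfolding riemannian_connection_def by simp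
  have F_J: "pr (F X (J \<cdot> Y)) = J \<cdot> pr (F X Y)" if "X \<in> VF" "Y \<in> CS" for X Y
    using herm that unfolding hermitian_connection_def pi_connection_def by simp
  have F_R_left: "F R Y = F Y R + lie_bracket R Y" if "Y \<in> VF" for Y
    using tors[OF that] by (simp add: torsion_def algebra_simps)
  have JJ: "J_ext A lam J \<cdot> X = J \<cdot> pr X" for X
    by (simp add: at_points_def J_ext_def)
  have nabla_of_R: "F Y R = nabla_of_R Y" if Y: "Y \<in> CS" for Y
  proof -
    have anti: "F (J \<cdot> Y) R = - (J \<cdot> F Y R)"
      using antiJ[OF Y] Y CR by (simp add: JJ pr_of_CS add_eq_0_iff2)
    have "F R (J \<cdot> Y) = J \<cdot> F R Y"
      using F_J[OF R_VF Y] Y CR by (simp add: F_R_left pr_of_CS)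
    then have "- (J \<cdot> F Y R) + lie_bracket R (J \<cdot> Y) = J \<cdot> F Y R + J \<cdot> lie_bracket R Y"
      using Y CR by (simp add: F_R_left anti J_simps)
    from arg_cong[OF this, of "\<lambda>X. J \<cdot> X"]
    have eq: "F Y R + J \<cdot> lie_bracket R (J \<cdot> Y) = - F Y R - lie_bracket R Y"
      using Y CR by (simp add: J_simps)
    show ?thesis
    proof (intro ext)
      fix p f
      show "F Y R p f = nabla_of_R Y p f"
        using fun_cong[OF fun_cong[OF eq, of p], of f]
        by (simp add: nabla_of_R_def nabla_R_def fscale_def tscale_def field_simps)
    qed
  qed
  have xi_conn: "pr (F X Y) = xi_conn X Y" if XY: "X \<in> CS" "Y \<in> CS" for X Y
  proof (rule xi_conn_unique[where F = "\<lambda>X Y. pr (F X Y)"])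
    show "pr (F (- X) Y) = - pr (F X Y)" if "X \<in> CS" "Y \<in> CS" for X Y
      using that F_fscale_left[of X Y "-1"] by (simp add: fscale_simps pr_simps)
    show "deriv_along X (h Y Z) = h (pr (F X Y)) Z + h Y (pr (F X Z))"
      if "X \<in> CS" "Y \<in> CS" "Z \<in> CS" for X Y Z
      using that F_metric[of X Y Z] by (simp add: g_eq L_CS pr_of_CS)
    show "pr (F (J \<cdot> Y) Y) - pr (F Y (J \<cdot> Y)) = xi_bracket (J \<cdot> Y) Y" if "Y \<in> CS" for Y
      using that torsJ[OF that] by (simp add: torsion_def pr_simps xi_bracket_def)
  qed (use XY F_J in \<open>simp_all add: F_add_left F_add_right pr_simps\<close>)
  have L: "L (F X Y) = - h Y (nabla_of_R X)" if XY: "X \<in> CS" "Y \<in> CS" for X Y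
    using XY F_metric[of X Y R]
    by (simp add: g_eq L_CS pr_of_CS L_R pr_R J_0 omega_0_right nabla_of_R deriv_along_simps add_eq_0_iff2)
  have FE: "F X Y = xi_conn X Y - fscale (h Y (nabla_of_R X)) R" if "X \<in> CS" "Y \<in> CS" for X Y
    using that decompose[of "F X Y"] by (simp add: xi_conn L fscale_simps)
  have "F X Y = triad_conn X Y" for X Y
  proof (cases "X \<in> VF \<and> Y \<in> VF")
    case True
    then have XY: "X \<in> VF" "Y \<in> VF" by auto
    let ?X = "pr X" and ?Y = "pr Y"
    have right: "F Z Y = fscale (deriv_along Z (L Y)) R + fscale (L Y) (F Z R) + F Z ?Y"
      if "Z \<in> VF" for Z
      using XY that by (subst decompose[of Y]) (simp add: F_add_right F_fscale_right)
    have 1: "F X Y = fscale (L X) (F R Y) + F ?X Y"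
      using XY by (subst decompose[of X]) (simp add: F_add_left F_fscale_left)
    have 2: "F R Y = fscale (deriv_along R (L Y)) R + nabla_R ?Y"
      using XY by (simp add: right RR fscale_simps F_R_left[of ?Y] nabla_of_R nabla_of_R_def)
    have 3: "F ?X Y = fscale (deriv_along ?X (L Y)) R + fscale (L Y) (nabla_of_R ?X)
        + (xi_conn ?X ?Y - fscale (h ?Y (nabla_of_R ?X)) R)"
      using XY by (simp add: right nabla_of_R FE)
    have 4: "deriv_along ?X (L Y) = deriv_along X (L Y) - L X * deriv_along R (L Y)"
      by (simp add: pr_eq deriv_along_simps)
    show ?thesis
      unfolding 1 2 3 4 using XY by (simp add: triad_conn_eq fscale_simps algebra_simps)
  next
    case False
    then have "F X Y = 0"
      using aff unfolding affine_connection_def by blast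
    then show ?thesis
      using False by (auto simp: triad_conn_def)
  qed
  then show ?thesis
    by (intro ext) simp
qed

end

theorem theorem1:
  fixes A :: "('a::{t2_space,second_countable_topology}, 'e::euclidean_space) atlas"
    and n :: nat
    and lam :: "'a \<Rightarrow> 'a tvec \<Rightarrow> real"
    and J :: "'a \<Rightarrow> 'a tvec \<Rightarrow> 'a tvec"
  assumes "contact_triad A n lam J"
  shows "\<exists>!D :: 'a conn.
    affine_connection A D \<and>
    riemannian_connection A (triad_metric A lam J) D \<and>
    (\<forall>Y\<in>vector_fields A. torsion D (reeb A lam) Y = 0) \<and>
    (D (reeb A lam) (reeb A lam) = 0 \<and>
     (\<forall>Y\<in>contact_sections A lam. D Y (reeb A lam) \<in> contact_sections A lam)) \<and>
    hermitian_connection A lam J (pi_connection A lam D) \<and>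
    (\<forall>Y\<in>contact_sections A lam. xi_proj A lam \<cdot> torsion D (J \<cdot> Y) Y = 0) \<and>
    (\<forall>Y\<in>contact_sections A lam.
       D (J \<cdot> Y) (reeb A lam) + J_ext A lam J \<cdot> D Y (reeb A lam) = 0)"
proof -
  interpret triad A n lam J
    using assms by unfold_locales (simp_all add: contact_triad_def)
  show ?thesis
  proof (intro ex1I[of _ triad_conn] conjI ballI)
    show "triad_conn R R = 0"
      by (simp add: triad_conn_Reeb pr_R nabla_of_R_0)
    show "triad_conn Y R \<in> CS" if "Y \<in> CS" for Y
      using that by (simp add: triad_conn_Reeb pr_of_CS)
  next
    fix F
    assume "affine_connection A F \<and> riemannian_connection A g F \<and>
      (\<forall>Y\<in>VF. torsion F R Y = 0) \<and> (F R R = 0 \<and> (\<forall>Y\<in>CS. F Y R \<in> CS)) \<and>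
      hermitian_connection A lam J (pi_connection A lam F) \<and>
      (\<forall>Y\<in>CS. pr (torsion F (J \<cdot> Y) Y) = 0) \<and>
      (\<forall>Y\<in>CS. F (J \<cdot> Y) R + J_ext A lam J \<cdot> F Y R = 0)"
    then show "F = triad_conn"
      by (elim conjE, intro connection_unique) simp_all
  qed (simp_all add: affine_triad_conn riemannian_triad_conn torsion_Reeb_triad_conn hermitian_triad_conn torsion_J_triad_conn J_ext_Reeb_triad_conn)
qed

end
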